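(* Let $d\ge1$, let $\lambda\vdash d$ be a Young diagram, and let $T,S\in\mathrm{Stab}(\lambda)$. Let $\sigma\in S_d$ be the permutation sending $T$ to $S$ (i.e. $\sigma T=S$). Then there exists a scalar $c\ne0$ such that, in $\mathbb{C}[S_d]$, $$E_{T,S}^\lambda=c\,E_T^\lambda\,\sigma^{-1}E_S^\lambda .$$
   Context: A Young diagram $\lambda\vdash d$ is a non-increasing sequence of positive integers with sum $d$. $\mathrm{Stab}(\lambda)$ is the set of standard fillings (standard Young tableaux) of $\lambda$, i.e. bijective fillings of the boxes by $1,\dots,d$ increasing along rows and columns. For a filling $T$ and $\sigma\in S_d$, $\sigma T$ is the filling obtained by replacing each entry $i$ by $\sigma(i)$. For $T\in\mathrm{Stab}(\lambda)$, $a_i(T)$ is the content (column index minus row index) of the box of $T$ containing $i$. $V_\lambda$ is the complex vector space with orthonormal basis $\{w_T: T\in\mathrm{Stab}(\lambda)\}$, on which $S_d$ acts irreducibly through the Coxeter generators $s_i=(i,i+1)$ as follows. If $s_iT$ is not standard, $s_iw_T=w_T$ when $i,i+1$ lie in the same row of $T$ and $s_iw_T=-w_T$ when they lie in the same column. If $S=s_iT$ is standard, $s_iw_T=\frac1r w_T+\sqrt{1-\frac1{r^2}}\,w_S$ and $s_iw_S=\sqrt{1-\frac1{r^2}}\,w_T-\frac1r w_S$, where $r=a_{i+1}(T)-a_i(T)$. These actions give a $*$-algebra isomorphism $\mathbb{C}[S_d]\cong\bigoplus_{\lambda\vdash d}\mathrm{End}(V_\lambda)$, by which the two sides are identified. The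 matrix unit $E_{T,S}^\lambda\in\mathbb{C}[S_d]$ corresponds to the operator with $E_{T,S}^\lambda w_R=\delta_{R,S}w_T$ for $R\in\mathrm{Stab}(\lambda)$, and which is zero on $V_\beta$ for $\beta\ne\lambda$; $E_T^\lambda:=E_{T,T}^\lambda$. *)

theory Defs
  imports Complex_Main "HOL-Combinatorics.Permutations"
begin

section \<open>Young diagrams and standard fillings\<close>

definition young_diagram :: "nat \<Rightarrow> nat list \<Rightarrow> bool" where
  "young_diagram d la \<longleftrightarrow>
     sorted_wrt (\<ge>) la \<and> (\<forall>k\<in>set la. k > 0) \<and> sum_list la = d"

text \<open>Boxes are pairs (row, column), both counted from 0; contents do not depend on this offset.\<close>

type_synonym box = "nat \<times> nat"
type_synonym filling = "box \<Rightarrow> nat"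

definition boxes :: "nat list \<Rightarrow> box set" where
  "boxes la = {(r, c). r < length la \<and> c < la ! r}"

text \<open>
  A filling is extended by 0 outside the diagram, so that it is determined by its entries. Every
  permutation of \<open>{1..d}\<close> fixes 0, hence the filling \<open>\<sigma>T\<close> is just the composition \<open>\<sigma> \<circ> T\<close>.
\<close>

definition is_filling :: "nat list \<Rightarrow> filling \<Rightarrow> bool" where
  "is_filling la T \<longleftrightarrow>
     bij_betw T (boxes la) {1..sum_list la} \<and> (\<forall>b. b \<notin> boxes la \<longrightarrow> T b = 0)"

definition Stab :: "nat list \<Rightarrow> filling set" where
  "Stab la = {T. is_filling la T \<and>
     (\<forall>r c c'. (r, c) \<in> boxes la \<and> (r, c') \<in> boxes la \<and> c < c' \<longrightarrow> T (r, c) < T (r, c')) \<and>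
     (\<forall>r r' c. (r, c) \<in> boxes la \<and> (r', c) \<in> boxes la \<and> r < r' \<longrightarrow> T (r, c) < T (r', c))}"

definition box_of :: "filling \<Rightarrow> nat \<Rightarrow> box" where
  "box_of T i = (THE b. T b = i)"

definition content :: "filling \<Rightarrow> nat \<Rightarrow> int" where
  "content T i = int (snd (box_of T i)) - int (fst (box_of T i))"

section \<open>The representation \<open>V\<^sub>\<lambda>\<close>\<close>

text \<open>
  Vectors of \<open>V\<^sub>\<lambda>\<close> are given by their coordinates in the basis \<open>w\<^sub>T\<close>, i.e. they are the functions
  that vanish outside \<open>Stab \<lambda>\<close>, and \<open>w\<^sub>T\<close> is \<open>basis_vec T\<close>.
\<close>

type_synonym vec = "filling \<Rightarrow> complex"

definition basis_vec :: "filling \<Rightarrow> vec" where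
  "basis_vec T = (\<lambda>R. if R = T then 1 else 0)"

text \<open>
  The vector \<open>s\<^sub>i w\<^sub>T\<close>. The rule for \<open>s\<^sub>i w\<^sub>S\<close> with \<open>S = s\<^sub>i T\<close> is the first branch with \<open>T\<close> and \<open>S\<close>
  exchanged, since this exchange replaces \<open>r\<close> by \<open>-r\<close>. For standard \<open>T\<close> with \<open>s\<^sub>i T\<close> not standard,
  \<open>i\<close> and \<open>i + 1\<close> lie in the same row or in the same column, so the last branch is the column case.
\<close>

definition coxeter_basis :: "nat list \<Rightarrow> nat \<Rightarrow> filling \<Rightarrow> vec" where
  "coxeter_basis la i T =
     (let S = transpose i (i + 1) \<circ> T;
          r = real_of_int (content T (i + 1) - content T i)
      in if S \<in> Stab la
         then (\<lambda>R. complex_of_real (1 / r) * basis_vec T R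
                 + complex_of_real (sqrt (1 - 1 / r\<^sup>2)) * basis_vec S R)
         else if fst (box_of T i) = fst (box_of T (i + 1)) then basis_vec T
         else (\<lambda>R. - basis_vec T R))"

definition coxeter_op :: "nat list \<Rightarrow> nat \<Rightarrow> vec \<Rightarrow> vec" where
  "coxeter_op la i v = (\<lambda>R. \<Sum>T\<in>Stab la. v T * coxeter_basis la i T R)"

text \<open>
  A permutation acts through any way of writing it as a product of the generators \<open>s\<^sub>1, \<dots>, s\<^sub>d\<^sub>-\<^sub>1\<close>.
  The operators \<open>coxeter_op\<close> satisfy the Coxeter relations on \<open>V\<^sub>\<lambda>\<close>, so the action on \<open>V\<^sub>\<lambda>\<close> does not
  depend on the chosen word.
\<close>

definition word_perm :: "nat list \<Rightarrow> nat \<Rightarrow> nat" where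
  "word_perm ws = foldr (\<lambda>i \<sigma>. transpose i (i + 1) \<circ> \<sigma>) ws id"

definition word_op :: "nat list \<Rightarrow> nat list \<Rightarrow> vec \<Rightarrow> vec" where
  "word_op la ws v = foldr (coxeter_op la) ws v"

definition perm_op :: "nat \<Rightarrow> nat list \<Rightarrow> (nat \<Rightarrow> nat) \<Rightarrow> vec \<Rightarrow> vec" where
  "perm_op d la \<sigma> = word_op la (SOME ws. set ws \<subseteq> {1..<d} \<and> word_perm ws = \<sigma>)"

section \<open>The group algebra of \<open>S\<^sub>d\<close> and its matrix units\<close>

type_synonym galg = "(nat \<Rightarrow> nat) \<Rightarrow> complex"

definition group_algebra :: "nat \<Rightarrow> galg set" where
  "group_algebra d = {x. \<forall>\<sigma>. \<not> \<sigma> permutes {1..d} \<longrightarrow> x \<sigma> = 0}"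

definition galg_perm :: "(nat \<Rightarrow> nat) \<Rightarrow> galg" where
  "galg_perm \<sigma> = (\<lambda>\<pi>. if \<pi> = \<sigma> then 1 else 0)"

definition galg_mult :: "nat \<Rightarrow> galg \<Rightarrow> galg \<Rightarrow> galg" where
  "galg_mult d x y =
     (\<lambda>\<pi>. \<Sum>(\<sigma>, \<tau>) | \<sigma> permutes {1..d} \<and> \<tau> permutes {1..d} \<and> \<sigma> \<circ> \<tau> = \<pi>. x \<sigma> * y \<tau>)"

definition galg_scale :: "complex \<Rightarrow> galg \<Rightarrow> galg" where
  "galg_scale c x = (\<lambda>\<pi>. c * x \<pi>)"

definition galg_op :: "nat \<Rightarrow> nat list \<Rightarrow> galg \<Rightarrow> vec \<Rightarrow> vec" where
  "galg_op d la x v = (\<lambda>R. \<Sum>\<sigma> | \<sigma> permutes {1..d}. x \<sigma> * perm_op d la \<sigma> v R)"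

text \<open>
  The preimage of the elementary operator under the isomorphism of the group algebra with the direct
  sum of all \<open>End V\<^sub>\<beta>\<close>; the isomorphism gives existence and uniqueness.
\<close>

definition matrix_unit :: "nat \<Rightarrow> nat list \<Rightarrow> filling \<Rightarrow> filling \<Rightarrow> galg" where
  "matrix_unit d la T S =
     (THE x. x \<in> group_algebra d \<and>
        (\<forall>\<beta>. young_diagram d \<beta> \<longrightarrow> (\<forall>R\<in>Stab \<beta>.
           galg_op d \<beta> x (basis_vec R) = (if \<beta> = la \<and> R = S then basis_vec T else (\<lambda>_. 0)))))"

end

theory Submission
  imports Defs "HOL-Library.Function_Algebras"
begin

text \<open>
  The operator \<open>E\<^sub>T \<sigma>\<^sup>-\<^sup>1 E\<^sub>S\<close> vanishes on every representation except \<open>V\<^sub>\<lambda>\<close>, where it sends \<open>w\<^sub>S\<close> to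
  \<open>a w\<^sub>T\<close> and the other basis vectors to 0, with \<open>a\<close> the coefficient of \<open>w\<^sub>T\<close> in \<open>\<sigma>\<^sup>-\<^sup>1 w\<^sub>S\<close>. So it is
  \<open>a E\<^sub>T\<^sub>,\<^sub>S\<close>, and the point is that \<open>a\<close> is not 0 (lemma \<open>perm_op_coefficient_neq_0\<close>).

  Standard fillings are the linear extensions of the diagram, ordered by row and column. They are
  cut out by comparisons between pairs of entries, and so they form a convex subset of the weak order:
  as long as \<open>T \<noteq> S\<close>, some \<open>s\<^sub>i\<close> brings \<open>T\<close> closer to \<open>S\<close>, measured by the number of inversions between
  the two, and such an \<open>s\<^sub>i T\<close> is again standard (\<open>ex_descent\<close>, \<open>descent_swap\<close>). This gives a word for
  \<open>\<sigma>\<^sup>-\<^sup>1\<close>, as long as the number of inversions, that leads from \<open>S\<close> to \<open>T\<close> through standard fillings. In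
  the expansion of the word applied to \<open>w\<^sub>S\<close>, only the term in which every letter moves the filling
  reaches \<open>T\<close>, since fewer moves create fewer inversions (\<open>word_support\<close>). Its coefficient is a product
  of factors \<open>\<surd>(1 - 1/r\<^sup>2)\<close> with \<open>\<bar>r\<bar> \<ge> 2\<close>, hence not 0 (\<open>geodesic_word\<close>).

  The rest shows that the symmetric group acts on every \<open>V\<^sub>\<beta>\<close> and that its group algebra is the direct
  sum of the algebras \<open>End V\<^sub>\<beta>\<close>. Without this, neither the action of a permutation nor a matrix unit
  is determined by its description.

  \<^item> The operators \<open>s\<^sub>i\<close> satisfy the Coxeter relations, by comparison of coefficients, and every word
    can be brought into a normal form that its permutation determines. So permutations act
    (\<open>braid_eq_complete\<close>, \<open>perm_op_comp\<close>).

  \<^item> Surjectivity: the operator \<open>w\<^sub>R \<mapsto> a\<^sub>k(R) w\<^sub>R\<close> comes from the group algebra for every \<open>k\<close>; it is the action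
    of a Jucys-Murphy element, obtained from the recursion \<open>X\<^sub>k\<^sub>+\<^sub>1 = s\<^sub>k X\<^sub>k s\<^sub>k + s\<^sub>k\<close> (\<open>content_recursion\<close>).
    The contents separate all pairs of a diagram and a standard filling of it, so Lagrange interpolation
    yields the projections \<open>E\<^sub>T\<close>, and the nonzero coefficients found above yield all \<open>E\<^sub>T\<^sub>,\<^sub>S\<close>
    (\<open>realisable_projection\<close>, \<open>realisable_matrix_unit\<close>).

  \<^item> Injectivity: the matrix units are linearly independent, and \<open>\<Sum>\<^sub>\<beta> |Stab \<beta>|\<^sup>2 = d!\<close> shows that there
    are as many of them as permutations, so they span the group algebra (\<open>sum_card_Stab_square\<close>,
    \<open>galg_faithful\<close>).
\<close>

section \<open>Standard fillings and contents\<close>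

abbreviation swap :: "nat \<Rightarrow> nat \<Rightarrow> nat" where
  "swap i \<equiv> Transposition.transpose i (Suc i)"

lemma box_of_swap: "box_of (swap i \<circ> T) k = box_of T (swap i k)"
proof -
  have "((swap i \<circ> T) b = k) = (T b = swap i k)" for b
    by (metis comp_apply transpose_involutory)
  then show ?thesis
    by (simp add: box_of_def)
qed

lemma content_swap: "content (swap i \<circ> T) k = content T (swap i k)"
  by (simp add: content_def box_of_swap)

lemma swap_comp_swap: "swap i \<circ> (swap i \<circ> T) = T"
  by (simp add: fun_eq_iff)

locale young_shape =
  fixes d :: nat and la :: "nat list"
  assumes young: "young_diagram d la"
begin

lemma sum_list_shape: "sum_list la = d"
  using young by (simp add: young_diagram_def)

lemma boxes_downward:
  assumes "(r', c') \<in> boxes la" "r \<le> r'" "c \<le> c'"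
  shows "(r, c) \<in> boxes la"
proof -
  have "la ! r' \<le> la ! r"
  proof (cases "r = r'")
    case False
    then show ?thesis
      using young assms by (auto simp: young_diagram_def boxes_def sorted_wrt_iff_nth_less)
  qed simp
  then show ?thesis
    using assms by (auto simp: boxes_def)
qed

lemma Stab_bij: "T \<in> Stab la \<Longrightarrow> bij_betw T (boxes la) {1..d}"
  by (simp add: Stab_def is_filling_def sum_list_shape)

lemma Stab_outside: "T \<in> Stab la \<Longrightarrow> b \<notin> boxes la \<Longrightarrow> T b = 0"
  unfolding Stab_def is_filling_def by blast

lemma Stab_mono:
  assumes T: "T \<in> Stab la" and b: "(r, c) \<in> boxes la" and b': "(r', c') \<in> boxes la"
    and le: "r \<le> r'" "c \<le> c'" and ne: "(r, c) \<noteq> (r', c')"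
  shows "T (r, c) < T (r', c')"
proof -
  have m: "(r, c') \<in> boxes la"
    using boxes_downward[OF b'] le by simp
  have "c < c' \<Longrightarrow> T (r, c) < T (r, c')" "r < r' \<Longrightarrow> T (r, c') < T (r', c')"
    using T b b' m by (auto simp: Stab_def)
  then show ?thesis
    using le ne by (cases "c = c'"; cases "r = r'") auto
qed

lemma box_of_entry: "T \<in> Stab la \<Longrightarrow> b \<in> boxes la \<Longrightarrow> box_of T (T b) = b"
  unfolding box_of_def
proof (rule the_equality)
  fix b' assume T: "T \<in> Stab la" and b: "b \<in> boxes la" and eq: "T b' = T b"
  have "T b \<in> {1..d}"
    using Stab_bij[OF T] b by (auto simp: bij_betw_def)
  then have "b' \<in> boxes la"
    using Stab_outside[OF T, of b'] eq by auto
  then show "b' = b"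
    using Stab_bij[OF T] b eq by (auto simp: bij_betw_def inj_on_def)
qed simp

lemma box_of:
  assumes "T \<in> Stab la" "1 \<le> k" "k \<le> d"
  shows "box_of T k \<in> boxes la" "T (box_of T k) = k"
proof -
  obtain b where "b \<in> boxes la" "T b = k"
    using bij_betw_imp_surj_on[OF Stab_bij[OF assms(1)]] assms(2,3)
    by (metis atLeastAtMost_iff imageE)
  then show "box_of T k \<in> boxes la" "T (box_of T k) = k"
    using box_of_entry[OF assms(1), of b] by simp_all
qed

lemma box_of_image:
  assumes T: "T \<in> Stab la"
  shows "box_of T ` {1..d} = boxes la"
proof
  show "box_of T ` {1..d} \<subseteq> boxes la"
    using box_of(1)[OF T] by auto
  show "boxes la \<subseteq> box_of T ` {1..d}"
  proof
    fix b assume "b \<in> boxes la"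
    then show "b \<in> box_of T ` {1..d}"
      using box_of_entry[OF T] bij_betw_apply[OF Stab_bij[OF T]] by (metis imageI)
  qed
qed

lemma finite_boxes: "finite (boxes la)"
proof -
  have "boxes la = (SIGMA r:{..<length la}. {..<la ! r})"
    by (auto simp: boxes_def)
  then show ?thesis
    by simp
qed

lemma finite_Stab: "finite (Stab la)"
proof (rule finite_subset)
  show "Stab la \<subseteq> {T. \<forall>b. (b \<in> boxes la \<longrightarrow> T b \<in> {1..d}) \<and> (b \<notin> boxes la \<longrightarrow> T b = 0)}"
    using Stab_bij Stab_outside by (fastforce simp: bij_betw_def)
  show "finite {T. \<forall>b. (b \<in> boxes la \<longrightarrow> T b \<in> {1..d}) \<and> (b \<notin> boxes la \<longrightarrow> T b = 0)}"
    using finite_boxes by (intro finite_set_of_finite_funs) auto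
qed

subsection \<open>Adjacent entries\<close>

lemma swap_bij: "T \<in> Stab la \<Longrightarrow> 1 \<le> i \<Longrightarrow> i < d \<Longrightarrow> bij_betw (swap i \<circ> T) (boxes la) {1..d}"
  by (rule bij_betw_trans[OF Stab_bij]) (auto simp: permutes_imp_bij permutes_swap_id)

lemma swap_less_iff:
  assumes "x \<noteq> y" "\<not> (x = i \<and> y = Suc i)" "\<not> (x = Suc i \<and> y = i)"
  shows "swap i x < swap i y \<longleftrightarrow> x < y"
  using assms by (auto simp: Transposition.transpose_def)

lemma swap_standardI:
  assumes T: "T \<in> Stab la" and i: "1 \<le> i" "i < d"
    and row: "fst (box_of T i) \<noteq> fst (box_of T (Suc i))"
    and col: "snd (box_of T i) \<noteq> snd (box_of T (Suc i))"
  shows "swap i \<circ> T \<in> Stab la"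
proof -
  have *: "swap i (T b) < swap i (T b')"
    if "b \<in> boxes la" "b' \<in> boxes la" "T b < T b'" "fst b = fst b' \<or> snd b = snd b'" for b b'
  proof -
    \<comment> \<open>The only comparison that could be reversed is the one between the boxes of \<open>i\<close> and \<open>i + 1\<close>.\<close>
    have "\<not> (T b = i \<and> T b' = Suc i)"
      using that row col box_of_entry[OF T, of b] box_of_entry[OF T, of b'] by metis
    then show ?thesis
      using that swap_less_iff[of "T b" "T b'" i] by auto
  qed
  have "is_filling la (swap i \<circ> T)"
    using swap_bij[OF T i] Stab_outside[OF T] i
    by (auto simp: is_filling_def sum_list_shape)
  moreover have "swap i (T (r, c)) < swap i (T (r, c'))"
    if "(r, c) \<in> boxes la" "(r, c') \<in> boxes la" "c < c'" for r c c'
    using that Stab_mono[OF T] by (intro *) auto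
  moreover have "swap i (T (r, c)) < swap i (T (r', c))"
    if "(r, c) \<in> boxes la" "(r', c) \<in> boxes la" "r < r'" for r r' c
    using that Stab_mono[OF T] by (intro *) auto
  ultimately show ?thesis
    by (auto simp: Stab_def)
qed

text \<open>
  Two consecutive entries cannot lie strictly south-east of one another, because the box at the corner
  between them would hold an entry in between. So they are neighbours in a row or in a column, or
  one is strictly south-west of the other, and then their contents are at least 2 apart.
\<close>

lemma adjacent_entries:
  assumes T: "T \<in> Stab la" and i: "1 \<le> i" "i < d"
  obtains (row) "fst (box_of T i) = fst (box_of T (Suc i))"
      "content T (Suc i) - content T i = 1" "swap i \<circ> T \<notin> Stab la"
  | (column) "fst (box_of T i) \<noteq> fst (box_of T (Suc i))"
      "content T (Suc i) - content T i = - 1" "swap i \<circ> T \<notin> Stab la"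
  | (apart) "\<bar>content T (Suc i) - content T i\<bar> \<ge> 2" "swap i \<circ> T \<in> Stab la"
proof -
  obtain r c r' c' where b: "box_of T i = (r, c)" and b': "box_of T (Suc i) = (r', c')"
    by (metis surj_pair)
  have bx: "(r, c) \<in> boxes la" "(r', c') \<in> boxes la" and ent: "T (r, c) = i" "T (r', c') = Suc i"
    using box_of[OF T, of i] box_of[OF T, of "Suc i"] i b b' by auto
  have "\<not> (r' \<le> r \<and> c' \<le> c)"
    using Stab_mono[OF T bx(2,1)] ent by force
  moreover have "r = r' \<or> c = c'" if "r \<le> r'" "c \<le> c'"
  proof (rule ccontr)
    assume ne: "\<not> ?thesis"
    have "(r, c') \<in> boxes la"
      using boxes_downward[OF bx(2)] that by simp
    then have "T (r, c) < T (r, c')" "T (r, c') < T (r', c')"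
      using Stab_mono[OF T] bx that ne by auto
    then show False
      using ent by simp
  qed
  ultimately consider (A) "r = r'" "c < c'" | (B) "c = c'" "r < r'"
    | (C) "r < r' \<and> c' < c \<or> r' < r \<and> c < c'"
    by linarith
  then show thesis
  proof cases
    case A
    have "c' = Suc c"
    proof (rule ccontr)
      assume "c' \<noteq> Suc c"
      then have "Suc c < c'"
        using A by simp
      moreover have "(r, Suc c) \<in> boxes la"
        using boxes_downward[OF bx(2)] A by simp
      ultimately have "T (r, c) < T (r, Suc c)" "T (r, Suc c) < T (r', c')"
        using Stab_mono[OF T] bx A by auto
      then show False
        using ent by simp
    qed
    moreover have "swap i \<circ> T \<notin> Stab la"
      using Stab_mono[of "swap i \<circ> T" r c r' c'] bx A ent by auto
    ultimately show thesis
      using row A b b' by (simp add: content_def)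
  next
    case B
    have "r' = Suc r"
    proof (rule ccontr)
      assume "r' \<noteq> Suc r"
      then have "Suc r < r'"
        using B by simp
      moreover have "(Suc r, c) \<in> boxes la"
        using boxes_downward[OF bx(2)] B by simp
      ultimately have "T (r, c) < T (Suc r, c)" "T (Suc r, c) < T (r', c')"
        using Stab_mono[OF T] bx B by auto
      then show False
        using ent by simp
    qed
    moreover have "swap i \<circ> T \<notin> Stab la"
      using Stab_mono[of "swap i \<circ> T" r c r' c'] bx B ent by auto
    ultimately show thesis
      using column B b b' by (simp add: content_def)
  next
    case C
    then have "swap i \<circ> T \<in> Stab la"
      using b b' by (intro swap_standardI[OF T i]) auto
    moreover have "\<bar>content T (Suc i) - content T i\<bar> \<ge> 2"
      using C b b' by (auto simp: content_def)
    ultimately show thesis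
      using apart by simp
  qed
qed

lemma content_Suc_neq:
  assumes "T \<in> Stab la" "1 \<le> i" "i < d"
  shows "content T (Suc i) \<noteq> content T i"
  using assms by (cases rule: adjacent_entries) auto

text \<open>
  If \<open>i\<close> and \<open>i + 2\<close> were on one diagonal, the two boxes next to the upper one would both have to contain
  \<open>i + 1\<close>. The braid relation needs this: its coefficients have \<open>a\<^sub>i\<^sub>+\<^sub>2 - a\<^sub>i\<close> in the denominator.
\<close>

lemma content_Suc_Suc_neq:
  assumes T: "T \<in> Stab la" and i: "1 \<le> i" "Suc i < d"
  shows "content T (Suc (Suc i)) \<noteq> content T i"
proof
  assume eq: "content T (Suc (Suc i)) = content T i"
  obtain r c r' c' where b: "box_of T i = (r, c)" and b': "box_of T (Suc (Suc i)) = (r', c')"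
    by (metis surj_pair)
  have bx: "(r, c) \<in> boxes la" "(r', c') \<in> boxes la" and ent: "T (r, c) = i" "T (r', c') = Suc (Suc i)"
    using box_of[OF T, of i] box_of[OF T, of "Suc (Suc i)"] i b b' by auto
  have "int c - int r = int c' - int r'"
    using eq b b' by (simp add: content_def)
  moreover have "\<not> (r' \<le> r \<and> c' \<le> c)"
    using Stab_mono[OF T bx(2,1)] ent by force
  ultimately have lt: "r < r'" "c < c'"
    by auto
  have m: "(r, Suc c) \<in> boxes la" "(Suc r, c) \<in> boxes la"
    using boxes_downward[OF bx(2)] lt by simp_all
  have "T (r, c) < T (r, Suc c)" "T (r, Suc c) < T (r', c')"
    "T (r, c) < T (Suc r, c)" "T (Suc r, c) < T (r', c')"
    using Stab_mono[OF T] bx m lt by auto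
  then have "T (r, Suc c) = T (Suc r, c)"
    using ent by simp
  then show False
    using inj_onD[OF bij_betw_imp_inj_on[OF Stab_bij[OF T]] _ m] by simp
qed

end

lemma boxes_determine_shape:
  assumes la: "young_diagram d la" and mu: "young_diagram d' mu" and bxs: "boxes la = boxes mu"
  shows "la = mu"
proof -
  have row: "(if r < length la then la ! r else 0) = (if r < length mu then mu ! r else 0)" for r
  proof -
    have "{c. (r, c) \<in> boxes la} = {..<if r < length la then la ! r else 0}"
      "{c. (r, c) \<in> boxes mu} = {..<if r < length mu then mu ! r else 0}"
      by (auto simp: boxes_def)
    then show ?thesis
      unfolding bxs by (simp only: lessThan_eq_iff)
  qed
  have pos: "r < length la \<Longrightarrow> 0 < la ! r" "r < length mu \<Longrightarrow> 0 < mu ! r" for r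
    using la mu by (auto simp: young_diagram_def)
  have len: "length la = length mu"
    using row[of "length mu"] row[of "length la"] pos
    by (metis less_irrefl linorder_neqE_nat)
  show ?thesis
  proof (rule nth_equalityI[OF len])
    fix r assume "r < length la"
    then show "la ! r = mu ! r"
      using row[of r] len by simp
  qed
qed

text \<open>
  On each diagonal the entries increase, so the box of an entry is the first box of its diagonal that
  is not occupied by a smaller entry. Hence the contents determine the filling, and with it the shape.
\<close>

lemma contents_determine_filling:
  assumes la: "young_diagram d la" and mu: "young_diagram d mu"
    and T: "T \<in> Stab la" and R: "R \<in> Stab mu"
    and eq: "\<And>k. 1 \<le> k \<Longrightarrow> k \<le> d \<Longrightarrow> content T k = content R k"
  shows "la = mu \<and> T = R"
proof -
  interpret L: young_shape d la by unfold_locales (fact la)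
  interpret M: young_shape d mu by unfold_locales (fact mu)
  have box: "box_of T k = box_of R k" if "1 \<le> k" "k \<le> d" for k
    using that
  proof (induction k rule: less_induct)
    case (less k)
    obtain r c r' c' where b: "box_of T k = (r, c)" and b': "box_of R k = (r', c')"
      by (metis surj_pair)
    have bx: "(r, c) \<in> boxes la" "(r', c') \<in> boxes mu" and ent: "T (r, c) = k" "R (r', c') = k"
      using L.box_of[OF T, of k] M.box_of[OF R, of k] less.prems b b' by auto
    have diag: "int c - int r = int c' - int r'"
      using eq[OF less.prems] b b' by (simp add: content_def)
    have "\<not> r < r'"
    proof
      assume lt: "r < r'"
      then have "(r, c) \<in> boxes mu"
        using M.boxes_downward[OF bx(2)] diag by simp
      then have "R (r, c) < k" "R (r, c) \<in> {1..d}" "box_of R (R (r, c)) = (r, c)"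
        using M.Stab_mono[OF R _ bx(2)] lt diag ent M.Stab_bij[OF R] M.box_of_entry[OF R]
        by (auto simp: bij_betw_def)
      moreover from this have "T (r, c) = R (r, c)"
        using less.IH[of "R (r, c)"] L.box_of(2)[OF T, of "R (r, c)"] by auto
      ultimately show False
        using ent by simp
    qed
    moreover have "\<not> r' < r"
    proof
      assume lt: "r' < r"
      then have "(r', c') \<in> boxes la"
        using L.boxes_downward[OF bx(1)] diag by simp
      then have "T (r', c') < k" "T (r', c') \<in> {1..d}" "box_of T (T (r', c')) = (r', c')"
        using L.Stab_mono[OF T _ bx(1)] lt diag ent L.Stab_bij[OF T] L.box_of_entry[OF T]
        by (auto simp: bij_betw_def)
      moreover from this have "R (r', c') = T (r', c')"
        using less.IH[of "T (r', c')"] M.box_of(2)[OF R, of "T (r', c')"] by auto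
      ultimately show False
        using ent by simp
    qed
    ultimately show ?case
      using diag b b' by simp
  qed
  have img: "box_of T ` {1..d} = boxes la" "box_of R ` {1..d} = boxes mu"
    by (rule L.box_of_image[OF T], rule M.box_of_image[OF R])
  have bxs: "boxes la = boxes mu"
    using box by (subst img[symmetric])+ (rule image_cong, auto)
  have "T b = R b" for b
  proof (cases "b \<in> boxes la")
    case True
    then have "T b \<in> {1..d}" "box_of T (T b) = b"
      using L.Stab_bij[OF T] L.box_of_entry[OF T] by (auto simp: bij_betw_def)
    then show ?thesis
      using box[of "T b"] M.box_of(2)[OF R, of "T b"] by auto
  next
    case False
    then show ?thesis
      using L.Stab_outside[OF T] M.Stab_outside[OF R] bxs by auto
  qed
  moreover have "la = mu"
    by (rule boxes_determine_shape[OF la mu bxs])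
  ultimately show ?thesis
    by auto
qed

lemma finite_young_diagrams: "finite {\<beta>. young_diagram d \<beta>}"
proof (rule finite_subset)
  have "length xs \<le> sum_list xs" if "\<forall>k\<in>set xs. k > 0" for xs :: "nat list"
    using that by (induction xs) auto
  then show "{\<beta>. young_diagram d \<beta>} \<subseteq> {xs. set xs \<subseteq> {..d} \<and> length xs \<le> d}"
    using member_le_sum_list by (fastforce simp: young_diagram_def)
  show "finite {xs. set xs \<subseteq> {..d} \<and> length xs \<le> d}"
    by (rule finite_lists_length_le) simp
qed

section \<open>The action of the Coxeter generators\<close>

definition axial :: "nat \<Rightarrow> filling \<Rightarrow> real" where
  "axial i T = real_of_int (content T (Suc i) - content T i)"

definition diag_coeff :: "nat \<Rightarrow> filling \<Rightarrow> complex" where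
  "diag_coeff i T = complex_of_real (1 / axial i T)"

definition swap_coeff :: "nat \<Rightarrow> filling \<Rightarrow> complex" where
  "swap_coeff i T = complex_of_real (sqrt (1 - 1 / (axial i T)\<^sup>2))"

definition vspace :: "nat list \<Rightarrow> (filling \<Rightarrow> complex) set" where
  "vspace la = {v. \<forall>R. R \<notin> Stab la \<longrightarrow> v R = 0}"

lemma vspaceD: "v \<in> vspace la \<Longrightarrow> R \<notin> Stab la \<Longrightarrow> v R = 0"
  by (simp add: vspace_def)

lemma basis_vec_vspace: "T \<in> Stab la \<Longrightarrow> basis_vec T \<in> vspace la"
  by (auto simp: vspace_def basis_vec_def)

lemma axial_swap: "axial i (swap i \<circ> T) = - axial i T"
  by (simp add: axial_def content_swap)

lemma diag_coeff_swap: "diag_coeff i (swap i \<circ> T) = - diag_coeff i T"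
  by (simp add: diag_coeff_def axial_swap)

lemma swap_coeff_swap: "swap_coeff i (swap i \<circ> T) = swap_coeff i T"
  by (simp add: swap_coeff_def axial_swap)

lemma swap_coeff_square:
  assumes "axial i T \<noteq> 0"
  shows "swap_coeff i T * swap_coeff i T = 1 - diag_coeff i T * diag_coeff i T"
proof -
  have "1 \<le> \<bar>content T (Suc i) - content T i\<bar>"
    using assms by (simp add: axial_def)
  then have "1 \<le> \<bar>axial i T\<bar>"
    unfolding axial_def by linarith
  then have "0 \<le> 1 - 1 / (axial i T)\<^sup>2"
    using assms by (simp add: abs_le_square_iff[of 1, simplified])
  then show ?thesis
    by (simp add: swap_coeff_def diag_coeff_def power2_eq_square flip: of_real_mult)
qed

context young_shape
begin

lemma axial_neq_0: "T \<in> Stab la \<Longrightarrow> 1 \<le> i \<Longrightarrow> i < d \<Longrightarrow> axial i T \<noteq> 0"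
  using content_Suc_neq[of T i] by (simp add: axial_def)

lemma swap_coeff_eq_0:
  assumes "T \<in> Stab la" "1 \<le> i" "i < d" "swap i \<circ> T \<notin> Stab la"
  shows "swap_coeff i T = 0"
  using assms(1-3)
proof (cases rule: adjacent_entries)
  case row
  then show ?thesis by (simp add: swap_coeff_def axial_def)
next
  case column
  then have "axial i T = -1"
    by (simp add: axial_def)
  then show ?thesis by (simp add: swap_coeff_def)
next
  case apart
  then show ?thesis using assms by simp
qed

lemma swap_coeff_neq_0:
  assumes "T \<in> Stab la" "1 \<le> i" "i < d" "swap i \<circ> T \<in> Stab la"
  shows "swap_coeff i T \<noteq> 0"
  using assms(1-3)
proof (cases rule: adjacent_entries)
  case apart
  then have "2 \<le> \<bar>axial i T\<bar>"
    unfolding axial_def by linarith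
  then have "(axial i T)\<^sup>2 \<noteq> 1"
    by (auto simp: power2_eq_1_iff)
  then show ?thesis
    by (auto simp: swap_coeff_def)
qed (use assms in auto)

lemma coxeter_basis_eq:
  assumes T: "T \<in> Stab la" and i: "1 \<le> i" "i < d"
  shows "coxeter_basis la i T R
    = diag_coeff i T * basis_vec T R + swap_coeff i T * basis_vec (swap i \<circ> T) R"
  using assms
proof (cases rule: adjacent_entries)
  case row
  then show ?thesis
    using swap_coeff_eq_0[OF T i]
    by (simp add: coxeter_basis_def Let_def diag_coeff_def axial_def)
next
  case column
  then have "axial i T = -1"
    by (simp add: axial_def)
  then show ?thesis
    using swap_coeff_eq_0[OF T i] column
    by (simp add: coxeter_basis_def Let_def diag_coeff_def)
next
  case apart
  then show ?thesis
    by (simp add: coxeter_basis_def Let_def diag_coeff_def swap_coeff_def axial_def)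
qed

text \<open>
  The action in coordinates. No case distinction is left, because for a filling that \<open>s\<^sub>i\<close> makes
  nonstandard \<open>r\<close> is 1 or -1, so that \<open>1/r\<close> is the sign of the action and \<open>\<surd>(1 - 1/r\<^sup>2)\<close> is 0.
\<close>

lemma coxeter_op_apply:
  assumes v: "v \<in> vspace la" and i: "1 \<le> i" "i < d" and R: "R \<in> Stab la"
  shows "coxeter_op la i v R = diag_coeff i R * v R + swap_coeff i R * v (swap i \<circ> R)"
proof -
  have eq: "basis_vec (swap i \<circ> T) R = basis_vec T (swap i \<circ> R)" for T
    by (metis basis_vec_def swap_comp_swap)
  have "coxeter_op la i v R
    = (\<Sum>T\<in>Stab la. v T * (diag_coeff i T * basis_vec T R))
    + (\<Sum>T\<in>Stab la. v T * (swap_coeff i T * basis_vec T (swap i \<circ> R)))"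
    by (simp add: coxeter_op_def coxeter_basis_eq[OF _ i] eq algebra_simps sum.distrib)
  also have "(\<Sum>T\<in>Stab la. v T * (diag_coeff i T * basis_vec T R)) = diag_coeff i R * v R"
    using R finite_Stab by (simp add: basis_vec_def if_distrib cong: if_cong)
  also have "(\<Sum>T\<in>Stab la. v T * (swap_coeff i T * basis_vec T (swap i \<circ> R)))
    = (if swap i \<circ> R \<in> Stab la then swap_coeff i (swap i \<circ> R) * v (swap i \<circ> R) else 0)"
    using finite_Stab by (simp add: basis_vec_def if_distrib cong: if_cong)
  also have "\<dots> = swap_coeff i R * v (swap i \<circ> R)"
    using vspaceD[OF v] by (simp add: swap_coeff_swap)
  finally show ?thesis .
qed

lemma coxeter_op_vspace: "coxeter_op la i v \<in> vspace la"
proof -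
  have "coxeter_basis la i T R = 0" if "T \<in> Stab la" "R \<notin> Stab la" for T R
    using that by (auto simp: coxeter_basis_def Let_def basis_vec_def)
  then show ?thesis
    by (simp add: vspace_def coxeter_op_def)
qed

text \<open>
  A swap coefficient vanishes where the swapped filling is not standard, so in a product with it
  the formula for the action may be used as if all fillings were standard.
\<close>

lemma swap_coeff_coxeter_op:
  assumes v: "v \<in> vspace la" and R: "R \<in> Stab la" and ij: "1 \<le> i" "i < d" "1 \<le> j" "j < d"
  shows "swap_coeff i R * coxeter_op la j v (swap i \<circ> R)
    = swap_coeff i R * (diag_coeff j (swap i \<circ> R) * v (swap i \<circ> R)
        + swap_coeff j (swap i \<circ> R) * v (swap j \<circ> (swap i \<circ> R)))"
  using coxeter_op_apply[OF v ij(3,4)] swap_coeff_eq_0[OF R ij(1,2)]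
  by (cases "swap i \<circ> R \<in> Stab la") auto

lemma swap_coeff2_coxeter_op:
  assumes v: "v \<in> vspace la" and R: "R \<in> Stab la"
    and ij: "1 \<le> i" "i < d" "1 \<le> j" "j < d" "1 \<le> k" "k < d"
  shows "swap_coeff i R * (swap_coeff j (swap i \<circ> R) * coxeter_op la k v (swap j \<circ> (swap i \<circ> R)))
    = swap_coeff i R * (swap_coeff j (swap i \<circ> R) *
       (diag_coeff k (swap j \<circ> (swap i \<circ> R)) * v (swap j \<circ> (swap i \<circ> R))
        + swap_coeff k (swap j \<circ> (swap i \<circ> R)) * v (swap k \<circ> (swap j \<circ> (swap i \<circ> R)))))"
  using swap_coeff_coxeter_op[OF v _ ij(3-6)] swap_coeff_eq_0[OF R ij(1,2)]
  by (cases "swap i \<circ> R \<in> Stab la") auto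

subsection \<open>The Coxeter relations\<close>

lemma coxeter_op_square:
  assumes v: "v \<in> vspace la" and i: "1 \<le> i" "i < d"
  shows "coxeter_op la i (coxeter_op la i v) = v"
proof
  fix R
  note w = coxeter_op_vspace[of i v]
  show "coxeter_op la i (coxeter_op la i v) R = v R"
  proof (cases "R \<in> Stab la")
    case True
    have "coxeter_op la i (coxeter_op la i v) R
      = (diag_coeff i R * diag_coeff i R + swap_coeff i R * swap_coeff i R) * v R"
      using coxeter_op_apply[OF w i True] coxeter_op_apply[OF v i True]
        swap_coeff_coxeter_op[OF v True i i]
      by (simp only: swap_comp_swap diag_coeff_swap swap_coeff_swap) (simp add: algebra_simps)
    then show ?thesis
      using swap_coeff_square[OF axial_neq_0[OF True i]] by simp
  next
    case False
    then show ?thesis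
      using vspaceD[OF v] vspaceD[OF coxeter_op_vspace] by simp
  qed
qed

lemma coxeter_op_commute:
  assumes v: "v \<in> vspace la" and i: "1 \<le> i" "i < d" and j: "1 \<le> j" "j < d" and far: "Suc i < j"
  shows "coxeter_op la i (coxeter_op la j v) = coxeter_op la j (coxeter_op la i v)"
proof
  fix R
  have content: "axial i (swap j \<circ> R) = axial i R" "axial j (swap i \<circ> R) = axial j R"
    using far by (simp_all add: axial_def content_swap)
  have comm: "swap i \<circ> (swap j \<circ> R) = swap j \<circ> (swap i \<circ> R)"
    using far by (auto simp: fun_eq_iff Transposition.transpose_def)
  show "coxeter_op la i (coxeter_op la j v) R = coxeter_op la j (coxeter_op la i v) R"
  proof (cases "R \<in> Stab la")
    case R: True
    show ?thesis
      using coxeter_op_apply[OF coxeter_op_vspace[of j v] i R] coxeter_op_apply[OF v i R]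
        coxeter_op_apply[OF coxeter_op_vspace[of i v] j R] coxeter_op_apply[OF v j R]
        swap_coeff_coxeter_op[OF v R i j] swap_coeff_coxeter_op[OF v R j i]
      by (simp add: diag_coeff_def swap_coeff_def content comm algebra_simps)
  next
    case False
    then show ?thesis
      using vspaceD[OF coxeter_op_vspace] by simp
  qed
qed

text \<open>
  The shape in which both sides of the braid relation are expanded below: \<open>z\<close> is the coordinate of a
  threefold product, and the coordinates of the inner products at swapped fillings are only known
  after multiplication with the coefficients \<open>P\<close> and \<open>Q\<close>.
\<close>

lemma three_steps:
  fixes p q P Q t U :: complex
  assumes "z = p * A + P * B" "A = q * C + Q * D" "P * B = P * (t * E + U * F)"
    "Q * D = Q * D'" "P * E = P * E'" "P * (U * F) = P * (U * F')" "C = C'"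
  shows "z = p * (q * C' + Q * D') + P * (t * E' + U * F')"
proof -
  have "z = p * (q * C + Q * D) + (t * (P * E) + P * (U * F))"
    unfolding assms(1,2,3) by (simp add: algebra_simps)
  then show ?thesis
    unfolding assms(4-7) by (simp add: algebra_simps)
qed

text \<open>
  Write \<open>p\<close>, \<open>q\<close>, \<open>t\<close> for the inverses of \<open>a\<^sub>i\<^sub>+\<^sub>1 - a\<^sub>i\<close>, \<open>a\<^sub>i\<^sub>+\<^sub>2 - a\<^sub>i\<^sub>+\<^sub>1\<close>, \<open>a\<^sub>i\<^sub>+\<^sub>2 - a\<^sub>i\<close> and \<open>P\<close>, \<open>Q\<close>, \<open>U\<close> for the square
  roots of \<open>1 - p\<^sup>2\<close>, \<open>1 - q\<^sup>2\<close>, \<open>1 - t\<^sup>2\<close>. Both sides are combinations of the coordinates at the six fillings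
  that permute \<open>i\<close>, \<open>i + 1\<close>, \<open>i + 2\<close>, and their coefficients agree by the identity \<open>p q = (p + q) t\<close>.
\<close>

lemma coxeter_op_braid:
  assumes v: "v \<in> vspace la" and i: "1 \<le> i" "Suc i < d"
  shows "coxeter_op la i (coxeter_op la (Suc i) (coxeter_op la i v))
    = coxeter_op la (Suc i) (coxeter_op la i (coxeter_op la (Suc i) v))"
proof
  fix R
  let ?j = "Suc i"
  let ?s = "coxeter_op la i" and ?t = "coxeter_op la ?j"
  have i1: "1 \<le> i" "i < d" and j1: "1 \<le> ?j" "?j < d"
    using i by auto
  show "?s (?t (?s v)) R = ?t (?s (?t v)) R"
  proof (cases "R \<in> Stab la")
    case R: True
    define p q t where "p = diag_coeff i R" and "q = diag_coeff ?j R"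
      and "t = complex_of_real (1 / (axial i R + axial ?j R))"
    define P Q U where "P = swap_coeff i R" and "Q = swap_coeff ?j R"
      and "U = complex_of_real (sqrt (1 - 1 / (axial i R + axial ?j R)\<^sup>2))"
    let ?a = "swap i" and ?b = "swap ?j"
    have ax: "axial i (?b \<circ> R) = axial i R + axial ?j R"
      "axial ?j (?a \<circ> R) = axial i R + axial ?j R"
      "axial i (?b \<circ> (?a \<circ> R)) = axial ?j R" "axial ?j (?a \<circ> (?b \<circ> R)) = axial i R"
      by (simp_all add: axial_def content_swap Transposition.transpose_def)
    have co: "diag_coeff i (?b \<circ> R) = t" "swap_coeff i (?b \<circ> R) = U"
      "diag_coeff ?j (?a \<circ> R) = t" "swap_coeff ?j (?a \<circ> R) = U"
      "diag_coeff i (?b \<circ> (?a \<circ> R)) = q" "swap_coeff i (?b \<circ> (?a \<circ> R)) = Q"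
      "diag_coeff ?j (?a \<circ> (?b \<circ> R)) = p" "swap_coeff ?j (?a \<circ> (?b \<circ> R)) = P"
      "diag_coeff i (?a \<circ> R) = - p" "swap_coeff i (?a \<circ> R) = P"
      "diag_coeff ?j (?b \<circ> R) = - q" "swap_coeff ?j (?b \<circ> R) = Q"
      by (simp_all add: diag_coeff_def swap_coeff_def ax axial_swap p_def q_def t_def P_def Q_def U_def)
    have long: "?a \<circ> (?b \<circ> (?a \<circ> R)) = ?b \<circ> (?a \<circ> (?b \<circ> R))"
      by (auto simp: fun_eq_iff Transposition.transpose_def)
    note mem = coxeter_op_vspace[of i] coxeter_op_vspace[of ?j]
    have st: "?s (?t (?s v)) R = p * (q * (p * v R + P * v (?a \<circ> R))
        + Q * (t * v (?b \<circ> R) + U * v (?a \<circ> (?b \<circ> R))))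
      + P * (t * (- p * v (?a \<circ> R) + P * v R)
        + U * (q * v (?b \<circ> (?a \<circ> R)) + Q * v (?a \<circ> (?b \<circ> (?a \<circ> R)))))"
    proof (rule three_steps)
      show "?s (?t (?s v)) R = p * ?t (?s v) R + P * ?t (?s v) (?a \<circ> R)"
        using coxeter_op_apply[OF mem(2) i1 R] by (simp add: p_def P_def)
      show "?t (?s v) R = q * ?s v R + Q * ?s v (?b \<circ> R)"
        using coxeter_op_apply[OF mem(1) j1 R] by (simp add: q_def Q_def)
      show "P * ?t (?s v) (?a \<circ> R)
        = P * (t * ?s v (?a \<circ> R) + U * ?s v (?b \<circ> (?a \<circ> R)))"
        using swap_coeff_coxeter_op[OF mem(1) R i1 j1] by (simp only: co flip: P_def)
      show "Q * ?s v (?b \<circ> R) = Q * (t * v (?b \<circ> R) + U * v (?a \<circ> (?b \<circ> R)))"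
        using swap_coeff_coxeter_op[OF v R j1 i1] by (simp only: co flip: Q_def)
      show "P * ?s v (?a \<circ> R) = P * (- p * v (?a \<circ> R) + P * v R)"
        using swap_coeff_coxeter_op[OF v R i1 i1]
        by (simp only: swap_comp_swap co flip: P_def)
      show "P * (U * ?s v (?b \<circ> (?a \<circ> R)))
        = P * (U * (q * v (?b \<circ> (?a \<circ> R)) + Q * v (?a \<circ> (?b \<circ> (?a \<circ> R)))))"
        using swap_coeff2_coxeter_op[OF v R i1 j1 i1] by (simp only: co flip: P_def)
      show "?s v R = p * v R + P * v (?a \<circ> R)"
        using coxeter_op_apply[OF v i1 R] by (simp add: p_def P_def)
    qed
    have ts: "?t (?s (?t v)) R = q * (p * (q * v R + Q * v (?b \<circ> R))
        + P * (t * v (?a \<circ> R) + U * v (?b \<circ> (?a \<circ> R))))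
      + Q * (t * (- q * v (?b \<circ> R) + Q * v R)
        + U * (p * v (?a \<circ> (?b \<circ> R)) + P * v (?b \<circ> (?a \<circ> (?b \<circ> R)))))"
    proof (rule three_steps)
      show "?t (?s (?t v)) R = q * ?s (?t v) R + Q * ?s (?t v) (?b \<circ> R)"
        using coxeter_op_apply[OF mem(1) j1 R] by (simp add: q_def Q_def)
      show "?s (?t v) R = p * ?t v R + P * ?t v (?a \<circ> R)"
        using coxeter_op_apply[OF mem(2) i1 R] by (simp add: p_def P_def)
      show "Q * ?s (?t v) (?b \<circ> R)
        = Q * (t * ?t v (?b \<circ> R) + U * ?t v (?a \<circ> (?b \<circ> R)))"
        using swap_coeff_coxeter_op[OF mem(2) R j1 i1] by (simp only: co flip: Q_def)
      show "P * ?t v (?a \<circ> R) = P * (t * v (?a \<circ> R) + U * v (?b \<circ> (?a \<circ> R)))"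
        using swap_coeff_coxeter_op[OF v R i1 j1] by (simp only: co flip: P_def)
      show "Q * ?t v (?b \<circ> R) = Q * (- q * v (?b \<circ> R) + Q * v R)"
        using swap_coeff_coxeter_op[OF v R j1 j1]
        by (simp only: swap_comp_swap co flip: Q_def)
      show "Q * (U * ?t v (?a \<circ> (?b \<circ> R)))
        = Q * (U * (p * v (?a \<circ> (?b \<circ> R)) + P * v (?b \<circ> (?a \<circ> (?b \<circ> R)))))"
        using swap_coeff2_coxeter_op[OF v R j1 i1 j1] by (simp only: co flip: Q_def)
      show "?t v R = q * v R + Q * v (?b \<circ> R)"
        using coxeter_op_apply[OF v j1 R] by (simp add: q_def Q_def)
    qed
    have PQ: "P * P = 1 - p * p" "Q * Q = 1 - q * q"
      using swap_coeff_square[OF axial_neq_0[OF R i1]] swap_coeff_square[OF axial_neq_0[OF R j1]]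
      by (simp_all add: p_def q_def P_def Q_def)
    \<comment> \<open>From \<open>1/t = 1/p + 1/q\<close>.\<close>
    have pqt: "p * q = p * t + q * t"
    proof -
      have "axial i R + axial ?j R \<noteq> 0"
        using content_Suc_Suc_neq[OF R i] by (simp add: axial_def)
      moreover have "1 / axial i R + 1 / axial ?j R
        = (axial i R + axial ?j R) * (1 / axial i R * (1 / axial ?j R))"
        using axial_neq_0[OF R i1] axial_neq_0[OF R j1] by (simp add: field_simps)
      ultimately have "1 / axial i R * (1 / axial ?j R) = 1 / axial i R * (1 / (axial i R + axial ?j R))
          + 1 / axial ?j R * (1 / (axial i R + axial ?j R))"
        by (metis distrib_right nonzero_mult_div_cancel_left times_divide_eq_right mult.right_neutral
            mult.commute)
      then show ?thesis
        unfolding p_def q_def t_def diag_coeff_def of_real_mult[symmetric] of_real_add[symmetric]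
        by simp
    qed
    have c0: "p * (q * p) + t * (P * P) = q * (p * q) + t * (Q * Q)"
    proof -
      have "p * (p * q) - t * (p * p) = q * (p * q) - t * (q * q)"
        unfolding pqt by (simp add: algebra_simps)
      then show ?thesis
        unfolding PQ by (simp add: algebra_simps)
    qed
    have "?s (?t (?s v)) R = (p * (q * p) + t * (P * P)) * v R
       + P * (p * q - p * t) * v (?a \<circ> R) + Q * (p * t) * v (?b \<circ> R)
       + p * Q * U * v (?a \<circ> (?b \<circ> R)) + q * P * U * v (?b \<circ> (?a \<circ> R))
       + P * Q * U * v (?a \<circ> (?b \<circ> (?a \<circ> R)))"
      unfolding st by (simp add: algebra_simps)
    also have "\<dots> = (q * (p * q) + t * (Q * Q)) * v R
       + P * (q * t) * v (?a \<circ> R) + Q * (p * q - q * t) * v (?b \<circ> R)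
       + p * Q * U * v (?a \<circ> (?b \<circ> R)) + q * P * U * v (?b \<circ> (?a \<circ> R))
       + P * Q * U * v (?a \<circ> (?b \<circ> (?a \<circ> R)))"
      unfolding c0 using pqt by simp
    also have "\<dots> = ?t (?s (?t v)) R"
      unfolding ts long by (simp add: algebra_simps)
    finally show ?thesis .
  next
    case False
    then show ?thesis
      using vspaceD[OF coxeter_op_vspace] by simp
  qed
qed

end

section \<open>Words and permutations\<close>

text \<open>
  Words that can be transformed into each other by the Coxeter relations for \<open>s\<^sub>1, \<dots>, s\<^sub>d\<^sub>-\<^sub>1\<close>.
\<close>

inductive braid_eq :: "nat \<Rightarrow> nat list \<Rightarrow> nat list \<Rightarrow> bool" for d where
  by_refl: "braid_eq d u u"
| by_sym: "braid_eq d u w \<Longrightarrow> braid_eq d w u"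
| by_trans: "braid_eq d u v \<Longrightarrow> braid_eq d v w \<Longrightarrow> braid_eq d u w"
| by_square: "1 \<le> i \<Longrightarrow> i < d \<Longrightarrow> braid_eq d (a @ [i, i] @ b) (a @ b)"
| by_far: "1 \<le> i \<Longrightarrow> Suc i < j \<Longrightarrow> j < d \<Longrightarrow> braid_eq d (a @ [i, j] @ b) (a @ [j, i] @ b)"
| by_braid: "1 \<le> i \<Longrightarrow> Suc i < d \<Longrightarrow>
    braid_eq d (a @ [i, Suc i, i] @ b) (a @ [Suc i, i, Suc i] @ b)"

lemma braid_eq_context: "braid_eq d u w \<Longrightarrow> braid_eq d (a @ u @ b) (a @ w @ b)"
proof (induction rule: braid_eq.induct)
  case (by_square i a' b')
  then show ?case using braid_eq.by_square[of i d "a @ a'" "b' @ b"] by simp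
next
  case (by_far i j a' b')
  then show ?case using braid_eq.by_far[of i j d "a @ a'" "b' @ b"] by simp
next
  case (by_braid i a' b')
  then show ?case using braid_eq.by_braid[of i d "a @ a'" "b' @ b"] by simp
qed (blast intro: braid_eq.intros)+

lemma word_perm_Nil [simp]: "word_perm [] = id"
  by (simp add: word_perm_def)

lemma word_perm_Cons [simp]: "word_perm (i # w) = swap i \<circ> word_perm w"
  by (simp add: word_perm_def)

lemma word_perm_append [simp]: "word_perm (u @ w) = word_perm u \<circ> word_perm w"
  by (induction u) (simp_all add: comp_assoc)

lemma bij_word_perm: "bij (word_perm w)"
proof (induction w)
  case (Cons i w)
  then show ?case
    unfolding word_perm_Cons by (intro bij_comp) simp_all
qed (simp only: word_perm_Nil bij_id)

lemma word_perm_permutes: "set w \<subseteq> {1..<d} \<Longrightarrow> word_perm w permutes {1..d}"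
  by (induction w) (auto intro!: permutes_compose permutes_swap_id permutes_id)

lemma word_perm_braid_eq: "braid_eq d u w \<Longrightarrow> word_perm u = word_perm w"
proof (induction rule: braid_eq.induct)
  case (by_square i a b)
  then show ?case by (simp add: fun_eq_iff)
next
  case (by_far i j a b)
  then show ?case by (auto simp: fun_eq_iff Transposition.transpose_def intro!: arg_cong[of _ _ "word_perm a"])
next
  case (by_braid i a b)
  then show ?case by (auto simp: fun_eq_iff Transposition.transpose_def intro!: arg_cong[of _ _ "word_perm a"])
qed auto

subsection \<open>A normal form for words\<close>

text \<open>
  The words \<open>s\<^sub>n s\<^sub>n\<^sub>-\<^sub>1 \<dots> s\<^sub>j\<close> represent the cosets of \<open>S\<^sub>n\<close> in \<open>S\<^sub>n\<^sub>+\<^sub>1\<close>; the empty word is \<open>j = n + 1\<close>.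
\<close>

definition falling :: "nat \<Rightarrow> nat \<Rightarrow> nat list" where
  "falling n j = rev [j..<Suc n]"

lemma falling_snoc: "j \<le> n \<Longrightarrow> falling n j = falling n (Suc j) @ [j]"
  by (simp add: falling_def upt_conv_Cons del: upt_Suc)

lemma falling_empty: "falling n (Suc n) = []"
  by (simp add: falling_def)

lemma falling_split: "j \<le> i \<Longrightarrow> i \<le> n \<Longrightarrow> falling n j = falling n (Suc i) @ i # rev [j..<i]"
proof -
  assume "j \<le> i" "i \<le> n"
  then have "[j..<Suc n] = [j..<i] @ i # [Suc i..<Suc n]"
    using upt_add_eq_append[of j i "Suc n - i"] by (simp add: upt_conv_Cons del: upt_Suc)
  then show ?thesis
    by (simp add: falling_def del: upt_Suc)
qed

lemma set_falling: "1 \<le> j \<Longrightarrow> set (falling n j) \<subseteq> {1..<Suc n}"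
  by (auto simp: falling_def)

lemma word_perm_falling: "j \<le> Suc n \<Longrightarrow> word_perm (falling n j) j = Suc n"
proof (induction j rule: inc_induct)
  case base
  then show ?case by (simp add: falling_empty)
next
  case (step j)
  then show ?case by (simp add: falling_snoc)
qed

lemma braid_eq_commute_past:
  assumes "1 \<le> i" "i < d" "\<And>x. x \<in> set u \<Longrightarrow> 1 \<le> x \<and> x < d \<and> (Suc i < x \<or> Suc x < i)"
  shows "braid_eq d (u @ [i]) (i # u)"
  using assms(3)
proof (induction u)
  case Nil
  then show ?case by (simp add: braid_eq.by_refl)
next
  case (Cons x u)
  have "braid_eq d ([x] @ (u @ [i]) @ []) ([x] @ (i # u) @ [])"
    using Cons by (intro braid_eq_context) simp
  moreover have "braid_eq d ([] @ [x, i] @ u) ([] @ [i, x] @ u)"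
    using Cons.prems[of x] assms(1,2) braid_eq.by_far[of x i d "[]" u]
      braid_eq.by_sym[OF braid_eq.by_far[of i x d "[]" u]] by auto
  ultimately show ?case
    by (auto intro: braid_eq.by_trans)
qed

text \<open>
  A generator multiplied from the right to a coset representative either leads to another
  representative or can be moved to the left of it, where it becomes a generator of \<open>S\<^sub>n\<close>. In the last
  case the braid relation turns \<open>s\<^sub>i\<close> into \<open>s\<^sub>i\<^sub>-\<^sub>1\<close> on the way.
\<close>

lemma falling_absorb:
  assumes n: "n < d" and j: "1 \<le> j" "j \<le> Suc n" and i: "1 \<le> i" "i \<le> n"
  shows "\<exists>w k. set w \<subseteq> {1..<n} \<and> 1 \<le> k \<and> k \<le> Suc n \<and> braid_eq d (falling n j @ [i]) (w @ falling n k)"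
proof -
  consider "j = Suc i" | "j = i" | "Suc i < j" | "j < i"
    by linarith
  then show ?thesis
  proof cases
    case 1
    then have "braid_eq d (falling n j @ [i]) ([] @ falling n i)"
      using i by (simp add: falling_snoc braid_eq.by_refl)
    then show ?thesis
      using i by (intro exI[of _ "[]"] exI[of _ i]) auto
  next
    case 2
    have "braid_eq d (falling n (Suc i) @ [i, i] @ []) (falling n (Suc i) @ [])"
      using i n by (intro braid_eq.by_square) auto
    then have "braid_eq d (falling n j @ [i]) ([] @ falling n (Suc i))"
      using 2 i by (simp add: falling_snoc)
    then show ?thesis
      using i by (intro exI[of _ "[]"] exI[of _ "Suc i"]) auto
  next
    case 3
    have "braid_eq d (falling n j @ [i]) (i # falling n j)"
      using 3 i n by (intro braid_eq_commute_past) (auto simp: falling_def)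
    then show ?thesis
      using 3 j i by (intro exI[of _ "[i]"] exI[of _ j]) auto
  next
    case 4
    then obtain k where k: "i = Suc k" "j \<le> k" "1 \<le> k"
      using j by (cases i) auto
    let ?h = "falling n (Suc i)" and ?t = "rev [j..<k]"
    have split: "falling n j = ?h @ [i, k] @ ?t"
      using falling_split[of j i n] k i by simp
    have "braid_eq d ((?h @ [i, k]) @ (?t @ [i]) @ []) ((?h @ [i, k]) @ (i # ?t) @ [])"
      using k i n j by (intro braid_eq_context braid_eq_commute_past) auto
    moreover have "braid_eq d (?h @ [i, k, i] @ ?t) (?h @ [k, i, k] @ ?t)"
      using braid_eq.by_sym[OF braid_eq.by_braid[of k d ?h ?t]] k i n by simp
    moreover have "braid_eq d ([] @ (?h @ [k]) @ ([i, k] @ ?t)) ([] @ (k # ?h) @ ([i, k] @ ?t))"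
      using k i n by (intro braid_eq_context braid_eq_commute_past) (auto simp: falling_def)
    ultimately have "braid_eq d (falling n j @ [i]) ([k] @ falling n j)"
      unfolding split by (auto intro: braid_eq.by_trans)
    then show ?thesis
      using k i j by (intro exI[of _ "[k]"] exI[of _ j]) auto
  qed
qed

lemma word_normal_form:
  assumes n: "n < d" and "set w \<subseteq> {1..<Suc n}"
  shows "\<exists>w' k. set w' \<subseteq> {1..<n} \<and> 1 \<le> k \<and> k \<le> Suc n \<and> braid_eq d w (w' @ falling n k)"
  using assms(2)
proof (induction w rule: rev_induct)
  case Nil
  then show ?case
    using braid_eq.by_refl by (intro exI[of _ "[]"] exI[of _ "Suc n"]) (auto simp: falling_empty)
next
  case (snoc i w)
  then obtain w' k where w: "set w' \<subseteq> {1..<n}" "1 \<le> k" "k \<le> Suc n" "braid_eq d w (w' @ falling n k)"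
    by auto
  obtain w'' k' where w': "set w'' \<subseteq> {1..<n}" "1 \<le> k'" "k' \<le> Suc n"
      "braid_eq d (falling n k @ [i]) (w'' @ falling n k')"
    using falling_absorb[OF n w(2,3), of i] snoc.prems by auto
  have "braid_eq d (w @ [i]) (w' @ falling n k @ [i])"
    using braid_eq_context[OF w(4), of "[]" "[i]"] by simp
  moreover have "braid_eq d (w' @ falling n k @ [i]) (w' @ w'' @ falling n k')"
    using braid_eq_context[OF w'(4), of w' "[]"] by simp
  ultimately have "braid_eq d (w @ [i]) ((w' @ w'') @ falling n k')"
    by (auto intro: braid_eq.by_trans)
  then show ?case
    using w(1) w'(1-3) by (intro exI[of _ "w' @ w''"] exI[of _ k']) auto
qed

text \<open>
  The Coxeter relations present the symmetric group: in the normal form, \<open>k\<close> is the preimage of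
  \<open>n + 1\<close>, so the permutation determines the coset representative, and by induction also the rest.
\<close>

lemma braid_eq_complete:
  assumes "n \<le> d" "set u \<subseteq> {1..<n}" "set w \<subseteq> {1..<n}" "word_perm u = word_perm w"
  shows "braid_eq d u w"
  using assms
proof (induction n arbitrary: u w)
  case 0
  then show ?case by (simp add: braid_eq.by_refl)
next
  case (Suc n)
  then have n: "n < d" by simp
  obtain u' j where u: "set u' \<subseteq> {1..<n}" "1 \<le> j" "j \<le> Suc n" "braid_eq d u (u' @ falling n j)"
    using word_normal_form[OF n Suc.prems(2)] by blast
  obtain w' k where w: "set w' \<subseteq> {1..<n}" "1 \<le> k" "k \<le> Suc n" "braid_eq d w (w' @ falling n k)"
    using word_normal_form[OF n Suc.prems(3)] by blast
  have pu: "word_perm u = word_perm u' \<circ> word_perm (falling n j)"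
    and pw: "word_perm w = word_perm w' \<circ> word_perm (falling n k)"
    using word_perm_braid_eq[OF u(4)] word_perm_braid_eq[OF w(4)] by simp_all
  have fix': "word_perm u' (Suc n) = Suc n" "word_perm w' (Suc n) = Suc n"
    using word_perm_permutes[OF u(1)] word_perm_permutes[OF w(1)] by (auto simp: permutes_def)
  have "word_perm u j = Suc n" "word_perm w k = Suc n"
    using fix' u(3) w(3) by (simp_all add: pu pw word_perm_falling)
  then have jk: "j = k"
    using bij_word_perm[of u] Suc.prems(4) by (metis bij_pointE)
  have "word_perm u' \<circ> word_perm (falling n k) = word_perm w' \<circ> word_perm (falling n k)"
    using pu pw jk Suc.prems(4) by metis
  then have "word_perm u' = word_perm w'"
    using bij_word_perm[of "falling n k"] by (metis bij_is_surj surj_fun_eq fun.set_map comp_apply ext surjD)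
  then have "braid_eq d u' w'"
    using Suc.IH[OF _ u(1) w(1)] n by simp
  then have "braid_eq d (u' @ falling n j) (w' @ falling n k)"
    using braid_eq_context[of d u' w' "[]" "falling n k"] jk by simp
  then show ?case
    using u(4) w(4) by (blast intro: braid_eq.intros)
qed

lemma word_perm_surj:
  assumes "\<sigma> permutes {1..n}"
  shows "\<exists>w. set w \<subseteq> {1..<n} \<and> word_perm w = \<sigma>"
  using assms
proof (induction n arbitrary: \<sigma>)
  case 0
  then show ?case by (intro exI[of _ "[]"]) (simp add: id_def)
next
  case (Suc n)
  obtain j where j: "1 \<le> j" "j \<le> Suc n" "\<sigma> j = Suc n"
    using permutes_image[OF Suc.prems] by (metis atLeastAtMost_iff imageE le_refl Suc_leI zero_less_Suc One_nat_def)
  let ?c = "word_perm (falling n j)"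
  have c: "?c permutes {1..Suc n}"
    using word_perm_permutes[OF set_falling[OF j(1)]] by simp
  define \<tau> where "\<tau> = \<sigma> \<circ> inv ?c"
  have "\<tau> permutes {1..Suc n}"
    unfolding \<tau>_def by (intro permutes_compose permutes_inv c Suc.prems)
  moreover have "\<tau> (Suc n) = Suc n"
    using j permutes_inverses[OF c] word_perm_falling[OF j(2)] by (simp add: \<tau>_def) (metis j(3))
  ultimately have "\<tau> permutes {1..n}"
    by (auto simp: permutes_def le_Suc_eq)
  then obtain w where w: "set w \<subseteq> {1..<n}" "word_perm w = \<tau>"
    using Suc.IH by blast
  have "word_perm (w @ falling n j) = \<sigma>"
    using permutes_inv_o(2)[OF c] by (simp add: w \<tau>_def comp_assoc)
  then show ?case
    using w(1) set_falling[OF j(1), of n] by (intro exI[of _ "w @ falling n j"]) auto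
qed

subsection \<open>The action of permutations\<close>

lemma word_op_Nil [simp]: "word_op la [] v = v"
  by (simp add: word_op_def)

lemma word_op_Cons [simp]: "word_op la (i # w) v = coxeter_op la i (word_op la w v)"
  by (simp add: word_op_def)

lemma word_op_append [simp]: "word_op la (u @ w) v = word_op la u (word_op la w v)"
  by (simp add: word_op_def)

lemma coxeter_op_sum:
  "coxeter_op la i (\<lambda>R. \<Sum>x\<in>A. c x * u x R) = (\<lambda>R. \<Sum>x\<in>A. c x * coxeter_op la i (u x) R)"
proof
  fix R
  have "(\<Sum>T\<in>Stab la. (\<Sum>x\<in>A. c x * u x T) * coxeter_basis la i T R)
    = (\<Sum>T\<in>Stab la. \<Sum>x\<in>A. c x * (u x T * coxeter_basis la i T R))"
    by (simp add: sum_distrib_right mult.assoc)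
  also have "\<dots> = (\<Sum>x\<in>A. c x * (\<Sum>T\<in>Stab la. u x T * coxeter_basis la i T R))"
    by (subst sum.swap) (simp add: sum_distrib_left)
  finally show "coxeter_op la i (\<lambda>R. \<Sum>x\<in>A. c x * u x R) R = (\<Sum>x\<in>A. c x * coxeter_op la i (u x) R)"
    by (simp add: coxeter_op_def)
qed

lemma word_op_sum:
  "word_op la w (\<lambda>R. \<Sum>x\<in>A. c x * u x R) = (\<lambda>R. \<Sum>x\<in>A. c x * word_op la w (u x) R)"
  by (induction w) (simp_all add: coxeter_op_sum)

lemma perm_op_sum:
  "perm_op d la \<sigma> (\<lambda>R. \<Sum>x\<in>A. c x * u x R) = (\<lambda>R. \<Sum>x\<in>A. c x * perm_op d la \<sigma> (u x) R)"
  by (simp add: perm_op_def word_op_sum)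

context young_shape
begin

lemma word_op_vspace: "v \<in> vspace la \<Longrightarrow> word_op la w v \<in> vspace la"
  by (cases w) (simp_all add: coxeter_op_vspace)

lemma word_op_braid_eq: "braid_eq d u w \<Longrightarrow> v \<in> vspace la \<Longrightarrow> word_op la u v = word_op la w v"
proof (induction arbitrary: v rule: braid_eq.induct)
  case (by_square i a b)
  then show ?case by (simp add: coxeter_op_square word_op_vspace)
next
  case (by_far i j a b)
  then show ?case using coxeter_op_commute[OF word_op_vspace[OF by_far(4)], of i j b] by simp
next
  case (by_braid i a b)
  then show ?case using coxeter_op_braid[OF word_op_vspace[OF by_braid(3)], of i b] by simp
qed auto

lemma perm_op_word_perm:
  assumes "set w \<subseteq> {1..<d}" "v \<in> vspace la"
  shows "perm_op d la (word_perm w) v = word_op la w v"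
proof -
  let ?P = "\<lambda>ws. set ws \<subseteq> {1..<d} \<and> word_perm ws = word_perm w"
  have "?P (SOME ws. ?P ws)"
    using assms(1) by (intro someI[of ?P w]) simp
  then have "braid_eq d (SOME ws. ?P ws) w"
    using assms(1) by (intro braid_eq_complete[OF le_refl]) auto
  then show ?thesis
    using word_op_braid_eq[OF _ assms(2)] by (simp add: perm_op_def)
qed

lemma perm_op_vspace: "v \<in> vspace la \<Longrightarrow> perm_op d la \<sigma> v \<in> vspace la"
  by (simp add: perm_op_def word_op_vspace)

lemma perm_op_comp:
  assumes "\<sigma> permutes {1..d}" "\<tau> permutes {1..d}" "v \<in> vspace la"
  shows "perm_op d la (\<sigma> \<circ> \<tau>) v = perm_op d la \<sigma> (perm_op d la \<tau> v)"
proof -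
  obtain u w where u: "set u \<subseteq> {1..<d}" "word_perm u = \<sigma>" and w: "set w \<subseteq> {1..<d}" "word_perm w = \<tau>"
    using word_perm_surj assms(1,2) by metis
  have "perm_op d la (word_perm (u @ w)) v = word_op la u (word_op la w v)"
    using u w assms(3) by (subst perm_op_word_perm) auto
  then show ?thesis
    using perm_op_word_perm u w assms(3) word_op_vspace by (auto simp: perm_op_vspace)
qed

end

section \<open>The group algebra\<close>

lemma finite_perms: "finite {\<sigma>. \<sigma> permutes {1..d::nat}}"
  by (simp add: finite_permutations)

lemma galg_perm_group_algebra: "\<sigma> permutes {1..d} \<Longrightarrow> galg_perm \<sigma> \<in> group_algebra d"
  by (auto simp: galg_perm_def group_algebra_def)

lemma galg_mult_group_algebra: "galg_mult d x y \<in> group_algebra d"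
proof -
  have "galg_mult d x y \<pi> = 0" if "\<not> \<pi> permutes {1..d}" for \<pi>
    unfolding galg_mult_def using that permutes_compose by (intro sum.neutral) blast
  then show ?thesis
    by (simp add: group_algebra_def)
qed

lemma galg_scale_group_algebra: "x \<in> group_algebra d \<Longrightarrow> galg_scale c x \<in> group_algebra d"
  by (simp add: group_algebra_def galg_scale_def)

lemma galg_op_perm: "\<sigma> permutes {1..d} \<Longrightarrow> galg_op d la (galg_perm \<sigma>) v = perm_op d la \<sigma> v"
proof
  fix R assume \<sigma>: "\<sigma> permutes {1..d}"
  have "galg_op d la (galg_perm \<sigma>) v R
    = (\<Sum>\<pi> | \<pi> permutes {1..d}. if \<pi> = \<sigma> then perm_op d la \<pi> v R else 0)"
    unfolding galg_op_def galg_perm_def by (rule sum.cong) auto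
  then show "galg_op d la (galg_perm \<sigma>) v R = perm_op d la \<sigma> v R"
    using \<sigma> finite_perms[of d] by simp
qed

lemma galg_op_scale: "galg_op d la (galg_scale c x) v = (\<lambda>R. c * galg_op d la x v R)"
  by (simp add: galg_op_def galg_scale_def sum_distrib_left mult.assoc)

lemma galg_op_add: "galg_op d la (\<lambda>\<pi>. x \<pi> + y \<pi>) v = (\<lambda>R. galg_op d la x v R + galg_op d la y v R)"
  by (simp add: galg_op_def distrib_right sum.distrib)

context young_shape
begin

lemma galg_op_vspace: "v \<in> vspace la \<Longrightarrow> galg_op d la x v \<in> vspace la"
  using perm_op_vspace by (auto simp: galg_op_def vspace_def intro!: sum.neutral)

lemma galg_op_mult:
  assumes v: "v \<in> vspace la"
  shows "galg_op d la (galg_mult d x y) v = galg_op d la x (galg_op d la y v)"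
proof
  fix R
  let ?G = "{\<sigma>. \<sigma> permutes {1..d}}"
  let ?h = "\<lambda>p. x (fst p) * y (snd p) * perm_op d la (fst p \<circ> snd p) v R"
  have "galg_op d la (galg_mult d x y) v R
    = (\<Sum>\<pi>\<in>?G. sum ?h {p \<in> ?G \<times> ?G. fst p \<circ> snd p = \<pi>})"
    unfolding galg_op_def galg_mult_def
  proof (rule sum.cong[OF refl])
    fix \<pi>
    have "{(\<sigma>, \<tau>). \<sigma> permutes {1..d} \<and> \<tau> permutes {1..d} \<and> \<sigma> \<circ> \<tau> = \<pi>}
      = {p \<in> ?G \<times> ?G. fst p \<circ> snd p = \<pi>}"
      by auto
    then show "(\<Sum>(\<sigma>, \<tau>) | \<sigma> permutes {1..d} \<and> \<tau> permutes {1..d} \<and> \<sigma> \<circ> \<tau> = \<pi>. x \<sigma> * y \<tau>)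
        * perm_op d la \<pi> v R
      = sum ?h {p \<in> ?G \<times> ?G. fst p \<circ> snd p = \<pi>}"
      by (auto simp: sum_distrib_right case_prod_unfold intro!: sum.cong)
  qed
  also have "\<dots> = sum ?h (?G \<times> ?G)"
    using finite_perms[of d] by (intro sum.group) (auto intro: permutes_compose)
  also have "\<dots> = (\<Sum>\<sigma>\<in>?G. \<Sum>\<tau>\<in>?G. x \<sigma> * y \<tau> * perm_op d la (\<sigma> \<circ> \<tau>) v R)"
    by (subst sum.cartesian_product) (simp add: case_prod_unfold)
  also have "\<dots> = (\<Sum>\<sigma>\<in>?G. x \<sigma> * (\<Sum>\<tau>\<in>?G. y \<tau> * perm_op d la \<sigma> (perm_op d la \<tau> v) R))"
    using v by (simp add: perm_op_comp sum_distrib_left mult.assoc)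
  also have "\<dots> = galg_op d la x (galg_op d la y v) R"
    unfolding galg_op_def by (simp add: perm_op_sum)
  finally show "galg_op d la (galg_mult d x y) v R = galg_op d la x (galg_op d la y v) R" .
qed

end

section \<open>Families of operators that come from the group algebra\<close>

text \<open>
  An element of the group algebra acts on all \<open>V\<^sub>\<beta>\<close> at once, so operators are treated as families
  indexed by the diagram \<open>\<beta>\<close>. The values of such a family count only on \<open>V\<^sub>\<beta>\<close>, for \<open>\<beta>\<close> of size \<open>d\<close>.
\<close>

definition realises :: "nat \<Rightarrow> galg \<Rightarrow> (nat list \<Rightarrow> (filling \<Rightarrow> complex) \<Rightarrow> (filling \<Rightarrow> complex)) \<Rightarrow> bool" where
  "realises d x F \<longleftrightarrow> x \<in> group_algebra d \<and>
     (\<forall>\<beta>. young_diagram d \<beta> \<longrightarrow> (\<forall>v\<in>vspace \<beta>. galg_op d \<beta> x v = F \<beta> v))"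

definition realisable :: "nat \<Rightarrow> (nat list \<Rightarrow> (filling \<Rightarrow> complex) \<Rightarrow> (filling \<Rightarrow> complex)) \<Rightarrow> bool" where
  "realisable d F \<longleftrightarrow> (\<exists>x. realises d x F)"

lemma realisable_cong:
  assumes "realisable d F" "\<And>\<beta> v. young_diagram d \<beta> \<Longrightarrow> v \<in> vspace \<beta> \<Longrightarrow> F \<beta> v = G \<beta> v"
  shows "realisable d G"
  using assms unfolding realisable_def realises_def by metis

lemma realises_perm: "\<sigma> permutes {1..d} \<Longrightarrow> realises d (galg_perm \<sigma>) (\<lambda>\<beta>. perm_op d \<beta> \<sigma>)"
  by (simp add: realises_def galg_perm_group_algebra galg_op_perm)

lemma realisable_word:
  assumes "set w \<subseteq> {1..<d}"
  shows "realisable d (\<lambda>\<beta>. word_op \<beta> w)"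
proof (rule realisable_cong)
  show "realisable d (\<lambda>\<beta>. perm_op d \<beta> (word_perm w))"
    unfolding realisable_def using realises_perm[OF word_perm_permutes[OF assms]] by blast
  show "perm_op d \<beta> (word_perm w) v = word_op \<beta> w v" if "young_diagram d \<beta>" "v \<in> vspace \<beta>" for \<beta> v
    using young_shape.perm_op_word_perm[OF young_shape.intro assms] that by simp
qed

lemma realisable_add:
  assumes "realisable d F" "realisable d G"
  shows "realisable d (\<lambda>\<beta> v R. F \<beta> v R + G \<beta> v R)"
proof -
  obtain x y where "realises d x F" "realises d y G"
    using assms by (auto simp: realisable_def)
  then have "realises d (\<lambda>\<pi>. x \<pi> + y \<pi>) (\<lambda>\<beta> v R. F \<beta> v R + G \<beta> v R)"
    by (simp add: realises_def galg_op_add group_algebra_def)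
  then show ?thesis
    unfolding realisable_def by blast
qed

lemma realises_scale: "realises d x F \<Longrightarrow> realises d (galg_scale c x) (\<lambda>\<beta> v R. c * F \<beta> v R)"
  by (simp add: realises_def galg_op_scale galg_scale_group_algebra)

lemma realises_mult:
  assumes x: "realises d x F" and y: "realises d y G"
  shows "realises d (galg_mult d x y) (\<lambda>\<beta> v. F \<beta> (G \<beta> v))"
proof -
  have "galg_op d \<beta> (galg_mult d x y) v = F \<beta> (G \<beta> v)"
    if \<beta>: "young_diagram d \<beta>" and v: "v \<in> vspace \<beta>" for \<beta> v
    using x y young_shape.galg_op_mult[OF young_shape.intro[OF \<beta>] v]
      young_shape.galg_op_vspace[OF young_shape.intro[OF \<beta>] v, of y] \<beta> v
    by (simp add: realises_def)
  then show ?thesis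
    by (simp add: realises_def galg_mult_group_algebra)
qed

lemma realisable_scale: "realisable d F \<Longrightarrow> realisable d (\<lambda>\<beta> v R. c * F \<beta> v R)"
  unfolding realisable_def using realises_scale by blast

lemma realisable_comp: "realisable d F \<Longrightarrow> realisable d G \<Longrightarrow> realisable d (\<lambda>\<beta> v. F \<beta> (G \<beta> v))"
  unfolding realisable_def using realises_mult by blast

abbreviation diag_op :: "(nat list \<Rightarrow> filling \<Rightarrow> complex) \<Rightarrow> nat list \<Rightarrow> (filling \<Rightarrow> complex) \<Rightarrow> (filling \<Rightarrow> complex)" where
  "diag_op g \<equiv> (\<lambda>\<beta> v R. g \<beta> R * v R)"

lemma realisable_diag_const: "realisable d (diag_op (\<lambda>_ _. c))"
  using realisable_scale[OF realisable_word[of "[]" d], of c] by simp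

lemma realisable_diag_mult:
  "realisable d (diag_op g) \<Longrightarrow> realisable d (diag_op h) \<Longrightarrow> realisable d (diag_op (\<lambda>\<beta> R. g \<beta> R * h \<beta> R))"
  using realisable_comp[of d "diag_op g" "diag_op h"] by (simp add: mult.assoc)

lemma realisable_diag_prod:
  "finite X \<Longrightarrow> (\<And>x. x \<in> X \<Longrightarrow> realisable d (diag_op (g x))) \<Longrightarrow>
    realisable d (diag_op (\<lambda>\<beta> R. \<Prod>x\<in>X. g x \<beta> R))"
proof (induction X rule: finite_induct)
  case empty
  then show ?case using realisable_diag_const[of d 1] by simp
next
  case (insert x X)
  then have "realisable d (diag_op (\<lambda>\<beta> R. g x \<beta> R * (\<Prod>x\<in>X. g x \<beta> R)))"
    by (intro realisable_diag_mult) auto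
  then show ?case using insert.hyps by simp
qed

context young_shape
begin

lemma content_first:
  assumes R: "R \<in> Stab la" and "1 \<le> d"
  shows "content R 1 = 0"
proof -
  obtain r c where b: "box_of R 1 = (r, c)"
    by (metis surj_pair)
  have bx: "(r, c) \<in> boxes la" "R (r, c) = 1"
    using box_of[OF R, of 1] assms(2) b by auto
  have z: "(0, 0) \<in> boxes la"
    using boxes_downward[OF bx(1)] by simp
  then have "R (0, 0) \<ge> 1"
    using bij_betw_apply[OF Stab_bij[OF R] z] by simp
  then have "(r, c) = (0, 0)"
    using Stab_mono[OF R z bx(1)] bx(2) by force
  then show ?thesis
    using b by (simp add: content_def)
qed

text \<open>
  The Jucys-Murphy elements \<open>X\<^sub>k = (1 k) + \<dots> + (k-1 k)\<close> satisfy \<open>X\<^sub>k\<^sub>+\<^sub>1 = s\<^sub>k X\<^sub>k s\<^sub>k + s\<^sub>k\<close>. The diagonal operators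
  with the contents as eigenvalues obey the same recursion, because \<open>1/r\<close> in the action of \<open>s\<^sub>k\<close> is the
  inverse of the difference of two contents.
\<close>

lemma content_recursion:
  assumes v: "v \<in> vspace la" and i: "1 \<le> i" "i < d"
  shows "of_int (content R (Suc i)) * v R
    = coxeter_op la i (\<lambda>Q. of_int (content Q i) * coxeter_op la i v Q) R + coxeter_op la i v R"
proof (cases "R \<in> Stab la")
  case R: True
  define a b x y where "a = diag_coeff i R" and "b = swap_coeff i R"
    and "x = complex_of_int (content R i)" and "y = complex_of_int (content R (Suc i))"
  define u where "u = coxeter_op la i v"
  have u: "(\<lambda>Q. of_int (content Q i) * u Q) \<in> vspace la"
    using coxeter_op_vspace[of i v] by (simp add: vspace_def u_def)
  have bu: "b * u (swap i \<circ> R) = b * (- a * v (swap i \<circ> R) + b * v R)"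
    using swap_coeff_coxeter_op[OF v R i i]
    by (simp only: swap_comp_swap diag_coeff_swap swap_coeff_swap a_def b_def u_def)
  have uR: "u R = a * v R + b * v (swap i \<circ> R)"
    using coxeter_op_apply[OF v i R] by (simp add: u_def a_def b_def)
  have "coxeter_op la i (\<lambda>Q. of_int (content Q i) * u Q) R = a * (x * u R) + y * (b * u (swap i \<circ> R))"
    using coxeter_op_apply[OF u i R] by (simp add: a_def b_def x_def y_def content_swap)
  also have "\<dots> + u R = (a * a * x + y * (b * b) + a) * v R + b * (1 - a * (y - x)) * v (swap i \<circ> R)"
    unfolding bu uR by (simp add: algebra_simps)
  also have "b * b = 1 - a * a"
    using swap_coeff_square[OF axial_neq_0[OF R i]] by (simp add: a_def b_def)
  also have "a * a * x + y * (1 - a * a) + a = y + a * (1 - a * (y - x))"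
    by (simp add: algebra_simps)
  also have "a * (y - x) = 1"
  proof -
    have "y - x = complex_of_real (axial i R)"
      by (simp add: x_def y_def axial_def)
    then show ?thesis
      using axial_neq_0[OF R i] by (simp add: a_def diag_coeff_def)
  qed
  finally show ?thesis
    by (simp add: u_def y_def)
next
  case False
  then show ?thesis
    using vspaceD[OF v] vspaceD[OF coxeter_op_vspace] by simp
qed

end

lemma realisable_content:
  assumes "1 \<le> k" "k \<le> d"
  shows "realisable d (diag_op (\<lambda>_ R. of_int (content R k)))"
  using assms
proof (induction k rule: dec_induct)
  case base
  show ?case
  proof (rule realisable_cong[OF realisable_diag_const[of d 0]])
    fix \<beta> and v :: "filling \<Rightarrow> complex" assume \<beta>: "young_diagram d \<beta>" and v: "v \<in> vspace \<beta>"
    interpret young_shape d \<beta> by unfold_locales (fact \<beta>)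
    show "(\<lambda>R. 0 * v R) = (\<lambda>R. of_int (content R 1) * v R)"
    proof
      fix R show "0 * v R = of_int (content R 1) * v R"
        using content_first[of R] base vspaceD[OF v, of R] by (cases "R \<in> Stab \<beta>") auto
    qed
  qed
next
  case (step k)
  have w: "realisable d (\<lambda>\<beta>. word_op \<beta> [k])"
    using step by (intro realisable_word) auto
  have D: "realisable d (diag_op (\<lambda>_ R. of_int (content R k)))"
    using step by simp
  show ?case
  proof (rule realisable_cong[OF realisable_add[OF realisable_comp[OF w realisable_comp[OF D w]] w]])
    fix \<beta> and v :: "filling \<Rightarrow> complex" assume \<beta>: "young_diagram d \<beta>" and v: "v \<in> vspace \<beta>"
    interpret young_shape d \<beta> by unfold_locales (fact \<beta>)
    show "(\<lambda>R. word_op \<beta> [k] (\<lambda>R. of_int (content R k) * word_op \<beta> [k] v R) R + word_op \<beta> [k] v R)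
      = (\<lambda>R. of_int (content R (Suc k)) * v R)"
      using content_recursion[OF v, of k] step by simp
  qed
qed

text \<open>
  Lagrange interpolation: for every other pair \<open>x\<close> of a diagram and a filling, some content separates
  \<open>x\<close> from \<open>T\<close>, and a suitable affine function \<open>g x\<close> of this content is 0 at \<open>x\<close> and 1 at \<open>T\<close>. The product
  of these functions is the indicator function of \<open>T\<close>.
\<close>

lemma realisable_projection:
  assumes la: "young_diagram d la" and T: "T \<in> Stab la"
  shows "realisable d (\<lambda>\<beta> v R. if \<beta> = la then v T * basis_vec T R else 0)"
proof -
  define X where "X = (SIGMA \<beta>:{\<beta>. young_diagram d \<beta>}. Stab \<beta>) - {(la, T)}"
  have fin: "finite X"
    unfolding X_def using young_shape.finite_Stab[OF young_shape.intro]
    by (intro finite_Diff finite_SigmaI finite_young_diagrams) auto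
  have "\<forall>x\<in>X. \<exists>k. 1 \<le> k \<and> k \<le> d \<and> content (snd x) k \<noteq> content T k"
    using contents_determine_filling[OF la _ T] unfolding X_def by fastforce
  then obtain k where k: "\<And>x. x \<in> X \<Longrightarrow> 1 \<le> k x \<and> k x \<le> d \<and> content (snd x) (k x) \<noteq> content T (k x)"
    by metis
  define g where "g x \<beta> R = (of_int (content R (k x)) - of_int (content (snd x) (k x)))
      / complex_of_int (content T (k x) - content (snd x) (k x))" for x :: "nat list \<times> filling" and \<beta> :: "nat list" and R
  have "realisable d (diag_op (g x))" if x: "x \<in> X" for x
  proof -
    let ?e = "complex_of_int (content T (k x) - content (snd x) (k x))"
    have "realisable d (\<lambda>\<beta> v R. 1 / ?e * (of_int (content R (k x)) * v R
        + (- of_int (content (snd x) (k x))) * v R))"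
      using k[OF x] by (intro realisable_scale realisable_add realisable_content realisable_diag_const) auto
    then show ?thesis
      by (rule realisable_cong) (simp add: g_def fun_eq_iff algebra_simps add_divide_distrib diff_divide_distrib)
  qed
  then have "realisable d (diag_op (\<lambda>\<beta> R. \<Prod>x\<in>X. g x \<beta> R))"
    by (intro realisable_diag_prod fin)
  then show ?thesis
  proof (rule realisable_cong)
    fix \<beta> and v :: "filling \<Rightarrow> complex" assume \<beta>: "young_diagram d \<beta>" and v: "v \<in> vspace \<beta>"
    show "(\<lambda>R. (\<Prod>x\<in>X. g x \<beta> R) * v R) = (\<lambda>R. if \<beta> = la then v T * basis_vec T R else 0)"
    proof
      fix R
      consider "R \<notin> Stab \<beta>" | "(\<beta>, R) \<in> X" | "\<beta> = la" "R = T"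
        using \<beta> by (auto simp: X_def)
      then show "(\<Prod>x\<in>X. g x \<beta> R) * v R = (if \<beta> = la then v T * basis_vec T R else 0)"
      proof cases
        case 1
        then show ?thesis
          using vspaceD[OF v] T by (auto simp: basis_vec_def)
      next
        case 2
        then have "(\<Prod>x\<in>X. g x \<beta> R) = 0"
          using fin by (intro prod_zero bexI[of _ "(\<beta>, R)"]) (auto simp: g_def)
        moreover have "\<beta> = la \<Longrightarrow> R \<noteq> T"
          using 2 by (auto simp: X_def)
        ultimately show ?thesis
          by (simp add: basis_vec_def)
      next
        case 3
        then have "g x \<beta> R = 1" if "x \<in> X" for x
          using k[OF that] by (simp add: g_def)
        then have "(\<Prod>x\<in>X. g x \<beta> R) = 1"
          by (intro prod.neutral) simp
        then show ?thesis
          using 3 by (simp add: basis_vec_def)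
      qed
    qed
  qed
qed

section \<open>Inversions between standard fillings\<close>

context young_shape
begin

definition inversions :: "filling \<Rightarrow> filling \<Rightarrow> (box \<times> box) set" where
  "inversions S T = {(b, b'). b \<in> boxes la \<and> b' \<in> boxes la \<and> S b < S b' \<and> T b' < T b}"

lemma finite_inversions: "finite (inversions S T)"
  by (rule finite_subset[of _ "boxes la \<times> boxes la"]) (auto simp: inversions_def finite_boxes)

lemma inversions_self: "inversions S S = {}"
  by (auto simp: inversions_def)

text \<open>
  Only the pair of the boxes of \<open>i\<close> and \<open>i + 1\<close> changes its relative order. Of its two orientations
  only the one that is increasing in \<open>S\<close> can be an inversion.
\<close>

lemma inversions_swap_subset:
  assumes T: "T \<in> Stab la" and i: "1 \<le> i" "i < d"
  shows "\<exists>p. inversions S (swap i \<circ> T) \<subseteq> insert p (inversions S T)"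
proof -
  let ?b = "box_of T i" and ?b' = "box_of T (Suc i)"
  let ?p = "if S ?b < S ?b' then (?b, ?b') else (?b', ?b)"
  have "p = ?p \<or> p \<in> inversions S T" if mem: "p \<in> inversions S (swap i \<circ> T)" for p
  proof -
    obtain b b' where p: "p = (b, b')" "b \<in> boxes la" "b' \<in> boxes la" "S b < S b'"
        "swap i (T b') < swap i (T b)"
      using mem by (auto simp: inversions_def)
    have bx: "box_of T (T b) = b" "box_of T (T b') = b'"
      using p box_of_entry[OF T] by auto
    have "T b' \<noteq> T b"
      using p(5) by auto
    then consider "T b = i" "T b' = Suc i" | "T b = Suc i" "T b' = i" | "T b' < T b"
      using swap_less_iff[of "T b'" "T b" i] p(5) by blast
    then show ?thesis
      using bx p by cases (auto simp: inversions_def)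
  qed
  then show ?thesis
    by (intro exI[of _ ?p]) blast
qed

lemma card_inversions_swap_le:
  assumes "T \<in> Stab la" "1 \<le> i" "i < d"
  shows "card (inversions S (swap i \<circ> T)) \<le> Suc (card (inversions S T))"
proof -
  obtain p where "inversions S (swap i \<circ> T) \<subseteq> insert p (inversions S T)"
    using inversions_swap_subset[OF assms] by blast
  then have "card (inversions S (swap i \<circ> T)) \<le> card (insert p (inversions S T))"
    by (intro card_mono) (simp_all add: finite_inversions)
  also have "\<dots> \<le> Suc (card (inversions S T))"
    by (simp add: card_insert_if finite_inversions)
  finally show ?thesis .
qed

text \<open>
  Convexity: if \<open>i\<close> and \<open>i + 1\<close> were in the same row or column, the order of their boxes would be the
  same in all standard fillings, and \<open>S\<close> could not disagree with \<open>T\<close> about it.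
\<close>

lemma descent_swap:
  assumes T: "T \<in> Stab la" and S: "S \<in> Stab la" and i: "1 \<le> i" "i < d"
    and desc: "S (box_of T (Suc i)) < S (box_of T i)"
  shows "swap i \<circ> T \<in> Stab la" "card (inversions S (swap i \<circ> T)) < card (inversions S T)"
proof -
  obtain r c r' c' where b: "box_of T i = (r, c)" and b': "box_of T (Suc i) = (r', c')"
    by (metis surj_pair)
  have bx: "(r, c) \<in> boxes la" "(r', c') \<in> boxes la" and ent: "T (r, c) = i" "T (r', c') = Suc i"
    using box_of[OF T, of i] box_of[OF T, of "Suc i"] i b b' by auto
  have "r \<noteq> r'"
    using Stab_mono[OF T bx(2,1)] Stab_mono[OF S bx] ent desc b b' by fastforce
  moreover have "c \<noteq> c'"
    using Stab_mono[OF T bx(2,1)] Stab_mono[OF S bx] ent desc b b' by fastforce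
  ultimately show "swap i \<circ> T \<in> Stab la"
    using b b' by (intro swap_standardI[OF T i]) auto
  have "inversions S (swap i \<circ> T) \<subseteq> inversions S T"
  proof
    fix p assume "p \<in> inversions S (swap i \<circ> T)"
    then obtain x x' where p: "p = (x, x')" "x \<in> boxes la" "x' \<in> boxes la" "S x < S x'"
        "swap i (T x') < swap i (T x)"
      by (auto simp: inversions_def)
    have "box_of T (T x) = x" "box_of T (T x') = x'"
      using p box_of_entry[OF T] by auto
    then have "\<not> (T x = i \<and> T x' = Suc i)"
      using p(4) desc by auto
    then show "p \<in> inversions S T"
      using swap_less_iff[of "T x'" "T x" i] p by (fastforce simp: inversions_def)
  qed
  moreover have "((r', c'), (r, c)) \<in> inversions S T - inversions S (swap i \<circ> T)"
    using bx ent desc b b' by (auto simp: inversions_def)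
  ultimately show "card (inversions S (swap i \<circ> T)) < card (inversions S T)"
    by (intro psubset_card_mono finite_inversions) blast
qed

text \<open>
  Without a disagreement about consecutive entries, reading \<open>S\<close> in the order of \<open>T\<close> gives a strictly
  increasing map from \<open>{1..d}\<close> to itself, which must be the identity.
\<close>

lemma ex_descent:
  assumes T: "T \<in> Stab la" and S: "S \<in> Stab la" and ne: "T \<noteq> S"
  shows "\<exists>i. 1 \<le> i \<and> i < d \<and> S (box_of T (Suc i)) < S (box_of T i)"
proof (rule ccontr)
  assume no: "\<not> ?thesis"
  define h where "h k = S (box_of T k)" for k
  have range: "1 \<le> h k" "h k \<le> d" if "1 \<le> k" "k \<le> d" for k
    using bij_betw_apply[OF Stab_bij[OF S] box_of(1)[OF T that]] by (auto simp: h_def)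
  have less: "h i < h (Suc i)" if "1 \<le> i" "i < d" for i
  proof -
    have "h i \<noteq> h (Suc i)"
      using box_of[OF T, of i] box_of[OF T, of "Suc i"] that
        inj_onD[OF bij_betw_imp_inj_on[OF Stab_bij[OF S]]] unfolding h_def
      by (metis Suc_leI le_SucI less_imp_le n_not_Suc_n)
    then show ?thesis
      using no that by (auto simp: h_def)
  qed
  have ge: "k \<le> h k" if "1 \<le> k" "k \<le> d" for k
    using that
  proof (induction k rule: dec_induct)
    case base
    then show ?case using range(1)[of 1] by simp
  next
    case (step k)
    then show ?case using less[of k] by simp
  qed
  have le: "h k \<le> k" if "1 \<le> k" "k \<le> d" for k
    using that(2,1)
  proof (induction k rule: inc_induct)
    case base
    then show ?case using range(2)[of d] by simp
  next
    case (step k)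
    then show ?case using less[of k] by simp
  qed
  have "T b = S b" for b
  proof (cases "b \<in> boxes la")
    case True
    then have "T b \<in> {1..d}" "box_of T (T b) = b"
      using bij_betw_apply[OF Stab_bij[OF T]] box_of_entry[OF T] by auto
    then show ?thesis
      using ge[of "T b"] le[of "T b"] by (simp add: h_def)
  next
    case False
    then show ?thesis
      using Stab_outside[OF T] Stab_outside[OF S] by simp
  qed
  then show False
    using ne by auto
qed

text \<open>
  Each letter adds at most one inversion.
\<close>

lemma word_support:
  assumes S: "S \<in> Stab la" and "set w \<subseteq> {1..<d}" and "R \<in> Stab la"
    and "word_op la w (basis_vec S) R \<noteq> 0"
  shows "card (inversions S R) \<le> length w"
  using assms(2-)
proof (induction w arbitrary: R)
  case Nil
  then have "R = S"
    by (auto simp: basis_vec_def split: if_splits)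
  then show ?case
    by (simp add: inversions_self)
next
  case (Cons i w)
  let ?u = "word_op la w (basis_vec S)"
  have i: "1 \<le> i" "i < d"
    using Cons.prems by auto
  have u: "?u \<in> vspace la"
    by (intro word_op_vspace basis_vec_vspace S)
  have "?u R \<noteq> 0 \<or> ?u (swap i \<circ> R) \<noteq> 0"
    using Cons.prems(3) coxeter_op_apply[OF u i Cons.prems(2)] by auto
  then show ?case
  proof
    assume "?u R \<noteq> 0"
    then show ?thesis
      using Cons by force
  next
    assume *: "?u (swap i \<circ> R) \<noteq> 0"
    then have R': "swap i \<circ> R \<in> Stab la"
      using vspaceD[OF u] by blast
    then have "card (inversions S (swap i \<circ> R)) \<le> length w"
      using Cons * by simp
    then show ?thesis
      using card_inversions_swap_le[OF R' i, of S] by (simp add: swap_comp_swap)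
  qed
qed

text \<open>
  In the last step of the word, \<open>w\<^sub>T\<close> can arise from \<open>w\<^sub>T\<close> or from \<open>w\<^sub>R\<close> with \<open>R = s\<^sub>i T\<close>. The first is
  excluded, as the remaining word is too short to reach \<open>T\<close>, and the second has a nonzero coefficient.
\<close>

lemma geodesic_word:
  assumes S: "S \<in> Stab la" and T: "T \<in> Stab la"
  shows "\<exists>w. set w \<subseteq> {1..<d} \<and> length w = card (inversions S T) \<and> word_perm w \<circ> S = T
    \<and> word_op la w (basis_vec S) T \<noteq> 0"
  using T
proof (induction "card (inversions S T)" arbitrary: T rule: less_induct)
  case (less T)
  show ?case
  proof (cases "T = S")
    case True
    then show ?thesis
      by (intro exI[of _ "[]"]) (simp add: inversions_self basis_vec_def)
  next
    case False
    then obtain i where i: "1 \<le> i" "i < d" "S (box_of T (Suc i)) < S (box_of T i)"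
      using ex_descent[OF less.prems S] by blast
    let ?T' = "swap i \<circ> T"
    note T' = descent_swap[OF less.prems S i]
    obtain w where w: "set w \<subseteq> {1..<d}" "length w = card (inversions S ?T')"
        "word_perm w \<circ> S = ?T'" "word_op la w (basis_vec S) ?T' \<noteq> 0"
      using less.hyps[OF T'(2,1)] by blast
    let ?u = "word_op la w (basis_vec S)"
    have u: "?u \<in> vspace la"
      by (intro word_op_vspace basis_vec_vspace S)
    have "?u T = 0"
      using word_support[OF S w(1) less.prems] T'(2) w(2) by auto
    then have "word_op la (i # w) (basis_vec S) T \<noteq> 0"
      using coxeter_op_apply[OF u i(1,2) less.prems] swap_coeff_neq_0[OF less.prems i(1,2) T'(1)] w(4)
      by simp
    moreover have "length (i # w) = card (inversions S T)"
      using T'(2) card_inversions_swap_le[OF T'(1) i(1,2), of S] w(2) by (simp add: swap_comp_swap)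
    moreover have "word_perm (i # w) \<circ> S = T"
      using w(3) by (simp add: comp_assoc swap_comp_swap)
    ultimately show ?thesis
      using w(1) i by (intro exI[of _ "i # w"]) simp
  qed
qed

lemma perm_op_coefficient_neq_0:
  assumes T: "T \<in> Stab la" and S: "S \<in> Stab la" and \<sigma>: "\<sigma> permutes {1..d}" "\<sigma> \<circ> T = S"
  shows "perm_op d la (inv \<sigma>) (basis_vec S) T \<noteq> 0"
proof -
  obtain w where w: "set w \<subseteq> {1..<d}" "word_perm w \<circ> S = T" "word_op la w (basis_vec S) T \<noteq> 0"
    using geodesic_word[OF S T] by blast
  have "word_perm w x = inv \<sigma> x" for x
  proof (cases "x \<in> {1..d}")
    case True
    then obtain b where x: "x = S b"
      using bij_betw_imp_surj_on[OF Stab_bij[OF S]] by blast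
    have "word_perm w x = T b"
      using fun_cong[OF w(2), of b] by (simp add: x)
    moreover have "x = \<sigma> (T b)"
      using fun_cong[OF \<sigma>(2), of b] by (simp add: x)
    ultimately show ?thesis
      by (simp add: permutes_inverses(2)[OF \<sigma>(1)])
  next
    case False
    then show ?thesis
      using word_perm_permutes[OF w(1)] permutes_inv[OF \<sigma>(1)] by (simp add: permutes_def)
  qed
  then have "word_perm w = inv \<sigma>"
    by (rule ext)
  then show ?thesis
    using perm_op_word_perm[OF w(1) basis_vec_vspace[OF S]] w(3) by simp
qed

text \<open>
  For a word leading from \<open>S\<close> to \<open>T\<close> with nonzero coefficient \<open>c\<close>, the product of the projection to \<open>w\<^sub>T\<close>,
  the word and the projection to \<open>w\<^sub>S\<close> is \<open>c E\<^sub>T\<^sub>,\<^sub>S\<close>.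
\<close>

lemma realisable_matrix_unit:
  assumes T: "T \<in> Stab la" and S: "S \<in> Stab la"
  shows "realisable d (\<lambda>\<beta> v R. if \<beta> = la then v S * basis_vec T R else 0)"
proof -
  obtain w where w: "set w \<subseteq> {1..<d}" "word_op la w (basis_vec S) T \<noteq> 0"
    using geodesic_word[OF S T] by blast
  let ?c = "word_op la w (basis_vec S) T"
  let ?P = "\<lambda>Q \<beta> v R. if \<beta> = la then v Q * basis_vec Q R else (0::complex)"
  have "realisable d (\<lambda>\<beta> v R. 1 / ?c * ?P T \<beta> (word_op \<beta> w (?P S \<beta> v)) R)"
    by (rule realisable_scale[OF realisable_comp[OF realisable_projection[OF young T]
        realisable_comp[OF realisable_word[OF w(1)] realisable_projection[OF young S]]]])
  then show ?thesis
  proof (rule realisable_cong)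
    fix \<beta> and v :: "filling \<Rightarrow> complex"
    have "word_op la w (\<lambda>R. v S * basis_vec S R) = (\<lambda>R. v S * word_op la w (basis_vec S) R)"
      using word_op_sum[of la w "\<lambda>_. v S" "\<lambda>_. basis_vec S" "{()}"] by simp
    then show "(\<lambda>R. 1 / ?c * ?P T \<beta> (word_op \<beta> w (?P S \<beta> v)) R)
      = (\<lambda>R. if \<beta> = la then v S * basis_vec T R else 0)"
      using w(2) by (auto simp: fun_eq_iff)
  qed
qed

end

section \<open>The sum of the squares of the numbers of standard fillings\<close>

text \<open>
  Induction over the size of a diagram is easier for the infinite sequence of row lengths, padded by
  zeros, where adding or removing a box is a function update.
\<close>

definition row :: "nat list \<Rightarrow> nat \<Rightarrow> nat" where
  "row la r = (if r < length la then la ! r else 0)"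

definition cells :: "(nat \<Rightarrow> nat) \<Rightarrow> box set" where
  "cells p = {(r, c). c < p r}"

definition shapes :: "nat \<Rightarrow> (nat \<Rightarrow> nat) set" where
  "shapes n = {p. antimono p \<and> finite (cells p) \<and> card (cells p) = n}"

definition tableaux :: "nat \<Rightarrow> (nat \<Rightarrow> nat) \<Rightarrow> filling set" where
  "tableaux n p = {T. bij_betw T (cells p) {1..n} \<and> (\<forall>b. b \<notin> cells p \<longrightarrow> T b = 0) \<and>
     (\<forall>r c c'. (r, c) \<in> cells p \<and> (r, c') \<in> cells p \<and> c < c' \<longrightarrow> T (r, c) < T (r, c')) \<and>
     (\<forall>r r' c. (r, c) \<in> cells p \<and> (r', c) \<in> cells p \<and> r < r' \<longrightarrow> T (r, c) < T (r', c))}"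

lemma cells_row: "cells (row la) = boxes la"
  by (auto simp: cells_def boxes_def row_def split: if_splits)

lemma Stab_eq_tableaux: "young_diagram n la \<Longrightarrow> Stab la = tableaux n (row la)"
  unfolding Stab_def tableaux_def is_filling_def cells_row
  by (auto simp: young_diagram_def)

lemma card_boxes: "card (boxes la) = sum_list la"
proof -
  have "boxes la = (SIGMA r:{..<length la}. {..<la ! r})"
    by (auto simp: boxes_def)
  then show ?thesis
    by (simp add: sum_list_sum_nth lessThan_atLeast0)
qed

lemma bij_betw_row: "bij_betw row {la. young_diagram n la} (shapes n)"
  unfolding bij_betw_def
proof
  show "inj_on row {la. young_diagram n la}"
    by (rule inj_onI) (metis boxes_determine_shape cells_row mem_Collect_eq)
  show "row ` {la. young_diagram n la} = shapes n"
  proof (intro equalityI subsetI)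
    fix p assume "p \<in> row ` {la. young_diagram n la}"
    then obtain la where la: "young_diagram n la" "p = row la"
      by blast
    interpret young_shape n la by unfold_locales (fact la)
    have "decseq (row la)"
      unfolding decseq_Suc_iff using young
      by (auto simp: row_def young_diagram_def sorted_wrt_iff_nth_less)
    then show "p \<in> shapes n"
      by (simp add: shapes_def la(2) cells_row finite_boxes card_boxes sum_list_shape)
  next
    fix p assume "p \<in> shapes n"
    then have p: "antimono p" "finite (cells p)" "card (cells p) = n"
      by (auto simp: shapes_def)
    have "\<exists>r. p r = 0"
    proof (rule ccontr)
      assume "\<not> ?thesis"
      then have "range (\<lambda>r. (r, 0)) \<subseteq> cells p"
        by (auto simp: cells_def)
      then have "finite (range (\<lambda>r::nat. (r, 0::nat)))"
        using p(2) finite_subset by blast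
      then show False
        by (simp add: finite_image_iff inj_on_def)
    qed
    define L where "L = (LEAST r. p r = 0)"
    have "p L = 0"
      unfolding L_def using \<open>\<exists>r. p r = 0\<close> by (rule LeastI_ex)
    then have zero: "p r = 0" if "L \<le> r" for r
      using antimonoD[OF p(1) that] by simp
    have pos: "0 < p r" if "r < L" for r
      using not_less_Least[of r "\<lambda>r. p r = 0"] that by (simp add: L_def)
    define la where "la = map p [0..<L]"
    have row: "row la = p"
      by (auto simp: row_def la_def fun_eq_iff zero)
    have "young_diagram n la"
      using p(3) pos antimonoD[OF p(1)]
      unfolding young_diagram_def card_boxes[symmetric] cells_row[symmetric] row
      by (auto simp: la_def sorted_wrt_iff_nth_less)
    then show "p \<in> row ` {la. young_diagram n la}"
      using row by blast
  qed
qed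

subsection \<open>Adding and removing a box\<close>

definition addable :: "(nat \<Rightarrow> nat) \<Rightarrow> nat set" where
  "addable p = {r. r = 0 \<or> p r < p (r - 1)}"

definition removable :: "(nat \<Rightarrow> nat) \<Rightarrow> nat set" where
  "removable p = {r. p (Suc r) < p r}"

definition grow :: "nat \<Rightarrow> (nat \<Rightarrow> nat) \<Rightarrow> nat \<Rightarrow> nat" where
  "grow r p = p(r := Suc (p r))"

definition shrink :: "nat \<Rightarrow> (nat \<Rightarrow> nat) \<Rightarrow> nat \<Rightarrow> nat" where
  "shrink r p = p(r := p r - 1)"

text \<open>
  One more box can be added than removed: below each row that can lose a box the next row can gain one,
  and the first row can always grow.
\<close>

lemma addable_removable: "addable p = insert 0 (Suc ` removable p)"
proof -
  have "r \<in> addable p \<longleftrightarrow> r \<in> insert 0 (Suc ` removable p)" for r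
    by (cases r) (auto simp: addable_def removable_def)
  then show ?thesis
    by blast
qed

lemma finite_removable:
  assumes "finite (cells p)"
  shows "finite (removable p)"
proof -
  have "removable p \<subseteq> fst ` cells p"
    by (force simp: removable_def cells_def image_iff)
  then show ?thesis
    using assms finite_subset by blast
qed

lemma finite_addable: "finite (cells p) \<Longrightarrow> finite (addable p)"
  by (simp add: addable_removable finite_removable)

lemma card_addable: "finite (cells p) \<Longrightarrow> card (addable p) = Suc (card (removable p))"
  by (simp add: addable_removable finite_removable card_image)

lemma shrink_grow: "shrink r (grow r p) = p"
  by (simp add: shrink_def grow_def)

lemma grow_shrink: "r \<in> removable p \<Longrightarrow> grow r (shrink r p) = p"
  by (auto simp: shrink_def grow_def removable_def fun_eq_iff)

lemma cells_grow: "cells (grow r p) = insert (r, p r) (cells p)"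
  by (auto simp: cells_def grow_def split: if_splits)

lemma removable_grow: "antimono p \<Longrightarrow> r \<in> removable (grow r p)"
  using antimonoD[of p r "Suc r"] by (simp add: removable_def grow_def)

lemma addable_shrink: "antimono p \<Longrightarrow> r \<in> removable p \<Longrightarrow> r \<in> addable (shrink r p)"
  using antimonoD[of p "r - 1" r] by (cases r) (auto simp: removable_def addable_def shrink_def)

lemma grow_shapes:
  assumes p: "p \<in> shapes n" and r: "r \<in> addable p"
  shows "grow r p \<in> shapes (Suc n)"
proof -
  have "decseq p"
    using p by (simp add: shapes_def)
  then have "decseq (grow r p)"
    using r unfolding decseq_Suc_iff by (auto simp: grow_def addable_def le_Suc_eq)
  moreover have "(r, p r) \<notin> cells p"
    by (simp add: cells_def)
  ultimately show ?thesis
    using p by (simp add: shapes_def cells_grow)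
qed

lemma shrink_shapes:
  assumes p: "p \<in> shapes (Suc n)" and r: "r \<in> removable p"
  shows "shrink r p \<in> shapes n"
proof -
  have p': "decseq p" "finite (cells p)" "card (cells p) = Suc n"
    using p by (auto simp: shapes_def)
  have "decseq (shrink r p)"
    using p'(1) r unfolding decseq_Suc_iff
    by (auto simp: shrink_def removable_def) (metis diff_le_self le_trans)
  moreover have "cells p = insert (r, shrink r p r) (cells (shrink r p))"
    by (subst grow_shrink[OF r, symmetric]) (rule cells_grow)
  moreover have "(r, shrink r p r) \<notin> cells (shrink r p)"
    by (simp add: cells_def)
  ultimately show ?thesis
    using p' by (simp add: shapes_def)
qed

lemma grow_shrink_commute: "r \<noteq> s \<Longrightarrow> shrink s (grow r p) = grow r (shrink s p)"
  by (auto simp: shrink_def grow_def)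

text \<open>
  Adding a box in one row and removing one in another row are independent operations. Together with
  \<open>card_addable\<close> this is the commutation relation \<open>D U - U D = 1\<close> of Young's lattice.
\<close>

lemma grow_shrink_swap:
  assumes "antimono p" "r \<noteq> s"
  shows "r \<in> addable p \<and> s \<in> removable (grow r p) \<longleftrightarrow> s \<in> removable p \<and> r \<in> addable (shrink s p)"
proof -
  have "p (Suc k) \<le> p k" for k
    using assms(1) decseq_Suc_iff by blast
  then show ?thesis
    using assms(2) by (cases r) (auto simp: addable_def removable_def grow_def shrink_def Suc_lessI le_less_trans)
qed

subsection \<open>The number of standard fillings\<close>

lemma tableaux_0:
  assumes "cells p = {}"
  shows "tableaux 0 p = {\<lambda>_. 0}"
  using assms by (auto simp: tableaux_def bij_betw_def)

lemma finite_tableaux: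
  assumes "finite (cells p)"
  shows "finite (tableaux n p)"
proof (rule finite_subset)
  show "tableaux n p \<subseteq> {T. \<forall>b. (b \<in> cells p \<longrightarrow> T b \<in> {1..n}) \<and> (b \<notin> cells p \<longrightarrow> T b = 0)}"
    by (fastforce simp: tableaux_def bij_betw_def)
  show "finite {T. \<forall>b. (b \<in> cells p \<longrightarrow> T b \<in> {1..n}) \<and> (b \<notin> cells p \<longrightarrow> T b = (0::nat))}"
    using assms by (intro finite_set_of_finite_funs) auto
qed

lemma insert_largest:
  assumes p: "antimono p" and s: "s \<in> removable p" and T: "T \<in> tableaux n (shrink s p)"
  shows "T((s, p s - 1) := Suc n) \<in> tableaux (Suc n) p"
proof -
  let ?b = "(s, p s - 1)"
  have cells: "cells p = insert ?b (cells (shrink s p))"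
    using cells_grow[of s "shrink s p"] by (simp add: grow_shrink[OF s]) (simp add: shrink_def)
  have new: "?b \<notin> cells (shrink s p)"
    by (simp add: cells_def shrink_def)
  have T': "bij_betw T (cells (shrink s p)) {1..n}" "\<And>b. b \<notin> cells (shrink s p) \<Longrightarrow> T b = 0"
    "\<And>r c c'. (r, c) \<in> cells (shrink s p) \<Longrightarrow> (r, c') \<in> cells (shrink s p) \<Longrightarrow> c < c' \<Longrightarrow> T (r, c) < T (r, c')"
    "\<And>r r' c. (r, c) \<in> cells (shrink s p) \<Longrightarrow> (r', c) \<in> cells (shrink s p) \<Longrightarrow> r < r' \<Longrightarrow> T (r, c) < T (r', c)"
    using T unfolding tableaux_def by blast+
  have small: "T b < Suc n" if "b \<in> cells (shrink s p)" for b
    using bij_betw_apply[OF T'(1) that] by simp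
  have corner: "\<not> (r = s \<and> p s - 1 < c)" "\<not> (s < r \<and> c = p s - 1)" if "(r, c) \<in> cells (shrink s p)" for r c
    using that s antimonoD[OF p, of "Suc s" r] by (auto simp: cells_def shrink_def removable_def split: if_splits)
  have bij: "bij_betw (T(?b := Suc n)) (cells p) {1..Suc n}"
  proof -
    have "bij_betw (T(?b := Suc n)) (cells (shrink s p)) {1..n}"
      using T'(1) new by (subst bij_betw_cong[of _ _ T]) auto
    then have "bij_betw (T(?b := Suc n)) (cells (shrink s p) \<union> {?b}) ({1..n} \<union> {(T(?b := Suc n)) ?b})"
      using new by (intro notIn_Un_bij_betw) auto
    then show ?thesis
      unfolding cells by (simp add: atLeastAtMostSuc_conv)
  qed
  have old: "b = ?b \<or> b \<in> cells (shrink s p)" if "b \<in> cells p" for b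
    using that cells by blast
  show ?thesis
    unfolding tableaux_def
  proof (intro CollectI conjI bij allI impI; (elim conjE)?)
    fix b assume "b \<notin> cells p"
    then show "(T(?b := Suc n)) b = 0"
      using T'(2) cells by auto
  next
    fix r c c' assume "(r, c) \<in> cells p" "(r, c') \<in> cells p" "c < c'"
    then show "(T(?b := Suc n)) (r, c) < (T(?b := Suc n)) (r, c')"
      using old[of "(r, c)"] old[of "(r, c')"] T'(3)[of r c c'] small[of "(r, c)"] corner[of r c'] new
      by (auto simp del: One_nat_def)
  next
    fix r r' c assume "(r, c) \<in> cells p" "(r', c) \<in> cells p" "r < r'"
    then show "(T(?b := Suc n)) (r, c) < (T(?b := Suc n)) (r', c)"
      using old[of "(r, c)"] old[of "(r', c)"] T'(4)[of r c r'] small[of "(r, c)"] corner[of r' c] new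
      by (auto simp del: One_nat_def)
  qed
qed

lemma remove_largest:
  assumes p: "antimono p" and T: "T \<in> tableaux (Suc n) p"
  shows "\<exists>s\<in>removable p. \<exists>T'\<in>tableaux n (shrink s p). T = T'((s, p s - 1) := Suc n)"
proof -
  have T': "bij_betw T (cells p) {1..Suc n}" "\<And>b. b \<notin> cells p \<Longrightarrow> T b = 0"
    "\<And>r c c'. (r, c) \<in> cells p \<Longrightarrow> (r, c') \<in> cells p \<Longrightarrow> c < c' \<Longrightarrow> T (r, c) < T (r, c')"
    "\<And>r r' c. (r, c) \<in> cells p \<Longrightarrow> (r', c) \<in> cells p \<Longrightarrow> r < r' \<Longrightarrow> T (r, c) < T (r', c)"
    using T unfolding tableaux_def by blast+
  have "Suc n \<in> T ` cells p"
    using bij_betw_imp_surj_on[OF T'(1)] by simp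
  then obtain s c where sc: "(s, c) \<in> cells p" "T (s, c) = Suc n"
    by auto
  have max: "T b \<le> Suc n" if "b \<in> cells p" for b
    using bij_betw_apply[OF T'(1) that] by simp
  have "\<not> Suc c < p s"
    using T'(3)[OF sc(1), of "Suc c"] max[of "(s, Suc c)"] sc(2) by (auto simp: cells_def)
  then have c: "c = p s - 1" "0 < p s"
    using sc(1) by (auto simp: cells_def)
  have "\<not> c < p (Suc s)"
    using T'(4)[OF sc(1), of "Suc s"] max[of "(Suc s, c)"] sc(2) by (auto simp: cells_def)
  then have s: "s \<in> removable p"
    using c by (auto simp: removable_def)
  have cells: "cells p = insert (s, c) (cells (shrink s p))"
    using cells_grow[of s "shrink s p"] c by (simp add: grow_shrink[OF s]) (simp add: shrink_def)
  have new: "(s, c) \<notin> cells (shrink s p)"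
    by (simp add: cells_def shrink_def c)
  define T0 where "T0 = T((s, c) := 0)"
  have eq: "T0 b = T b" if "b \<in> cells (shrink s p)" for b
    using that new by (auto simp: T0_def)
  have "bij_betw T (cells p - {(s, c)}) ({1..Suc n} - {T (s, c)})"
    using T'(1) sc(1) by (intro bij_betw_DiffI) (auto simp: bij_betw_def)
  moreover have "cells p - {(s, c)} = cells (shrink s p)" "{1..Suc n} - {T (s, c)} = {1..n}"
    using cells new sc(2) by auto
  ultimately have "bij_betw T0 (cells (shrink s p)) {1..n}"
    using eq by (subst bij_betw_cong[of _ _ T]) auto
  moreover have "T0 b = 0" if "b \<notin> cells (shrink s p)" for b
    using that T'(2) cells by (auto simp: T0_def)
  moreover have "T0 (r, c) < T0 (r, c')"
    if "(r, c) \<in> cells (shrink s p)" "(r, c') \<in> cells (shrink s p)" "c < c'" for r c c'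
    using that T'(3) cells by (simp add: eq)
  moreover have "T0 (r, c) < T0 (r', c)"
    if "(r, c) \<in> cells (shrink s p)" "(r', c) \<in> cells (shrink s p)" "r < r'" for r r' c
    using that T'(4) cells by (simp add: eq)
  ultimately have "T0 \<in> tableaux n (shrink s p)"
    unfolding tableaux_def by blast
  moreover have "T = T0((s, p s - 1) := Suc n)"
    using sc(2) c by (auto simp: T0_def fun_eq_iff)
  ultimately show ?thesis
    using s by blast
qed

text \<open>
  The largest entry sits in a corner, and removing it leaves a standard filling of the smaller shape.
\<close>

lemma card_tableaux_Suc:
  assumes p: "antimono p" "finite (cells p)"
  shows "card (tableaux (Suc n) p) = (\<Sum>s\<in>removable p. card (tableaux n (shrink s p)))"
proof -
  let ?f = "\<lambda>s T. T((s, p s - 1) := Suc n)"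
  have val: "T b \<le> n" if "T \<in> tableaux n q" for T q b
  proof (cases "b \<in> cells q")
    case True
    then show ?thesis
      using that bij_betw_apply[of T "cells q" "{1..n}" b] by (simp add: tableaux_def)
  next
    case False
    then have "T b = 0"
      using that unfolding tableaux_def by blast
    then show ?thesis by simp
  qed
  have fin: "finite (tableaux n (shrink s p))" if "s \<in> removable p" for s
  proof -
    have "cells (shrink s p) \<subseteq> cells p"
      by (auto simp: cells_def shrink_def split: if_splits)
    then show ?thesis
      using p(2) finite_subset finite_tableaux by blast
  qed
  have inj: "inj_on (?f s) (tableaux n (shrink s p))" for s
  proof (rule inj_onI)
    fix T T' assume T: "T \<in> tableaux n (shrink s p)" "T' \<in> tableaux n (shrink s p)" "?f s T = ?f s T'"
    have "(s, p s - 1) \<notin> cells (shrink s p)"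
      by (simp add: cells_def shrink_def)
    then have "T (s, p s - 1) = T' (s, p s - 1)"
      using T(1,2) unfolding tableaux_def by auto
    then show "T = T'"
      using T(3) by (metis fun_upd_triv fun_upd_upd)
  qed
  have disj: "?f s ` tableaux n (shrink s p) \<inter> ?f s' ` tableaux n (shrink s' p) = {}" if "s \<noteq> s'" for s s'
  proof (rule ccontr)
    assume "\<not> ?thesis"
    then obtain T T' where T: "T' \<in> tableaux n (shrink s' p)" "?f s T = ?f s' T'"
      by auto
    have "Suc n = T' (s, p s - 1)"
      using fun_cong[OF T(2), of "(s, p s - 1)"] that by simp
    then show False
      using val[OF T(1), of "(s, p s - 1)"] by simp
  qed
  have "tableaux (Suc n) p = (\<Union>s\<in>removable p. ?f s ` tableaux n (shrink s p))"
    using insert_largest[OF p(1)] remove_largest[OF p(1)] by fastforce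
  then have "card (tableaux (Suc n) p) = (\<Sum>s\<in>removable p. card (?f s ` tableaux n (shrink s p)))"
    using finite_removable[OF p(2)] fin disj by (simp only:) (intro card_UN_disjoint, auto)
  then show ?thesis
    using inj by (simp add: card_image)
qed

text \<open>
  Let \<open>f\<close> count standard fillings and sum \<open>f\<close> over the shapes above \<open>p\<close>. Each of these values is the sum
  of \<open>f\<close> over the shapes obtained by removing a box again. The box just added accounts for
  \<open>|addable p| = |removable p| + 1\<close> copies of \<open>f p\<close>. In the other terms the removal may be done first, and
  the induction hypothesis for the smaller shapes shows that they and \<open>|removable p|\<close> copies of \<open>f p\<close> add
  up to \<open>n f p\<close>.
\<close>

lemma sum_card_tableaux_grow:
  assumes "p \<in> shapes n"
  shows "(\<Sum>r\<in>addable p. card (tableaux (Suc n) (grow r p))) = Suc n * card (tableaux n p)"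
  using assms
proof (induction n arbitrary: p rule: less_induct)
  case (less n)
  let ?f = "\<lambda>p. card (tableaux n p)"
  have p: "antimono p" "finite (cells p)" "card (cells p) = n"
    using less.prems by (auto simp: shapes_def)
  let ?X = "\<Sum>r\<in>addable p. \<Sum>s\<in>removable (grow r p) - {r}. ?f (shrink s (grow r p))"
  let ?Y = "\<Sum>s\<in>removable p. \<Sum>r\<in>addable (shrink s p) - {s}. ?f (grow r (shrink s p))"
  have finG: "finite (removable (grow r p))" for r
    using p(2) by (intro finite_removable) (simp add: cells_grow)
  have finS: "finite (cells (shrink s p))" for s
    by (rule finite_subset[OF _ p(2)]) (auto simp: cells_def shrink_def split: if_splits)
  have "(\<Sum>r\<in>addable p. card (tableaux (Suc n) (grow r p)))
    = (\<Sum>r\<in>addable p. \<Sum>s\<in>removable (grow r p). ?f (shrink s (grow r p)))"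
    using grow_shapes[OF less.prems] by (intro sum.cong refl card_tableaux_Suc) (auto simp: shapes_def)
  also have "\<dots> = (\<Sum>r\<in>addable p. ?f p + (\<Sum>s\<in>removable (grow r p) - {r}. ?f (shrink s (grow r p))))"
    by (intro sum.cong refl, subst sum.remove[OF finG removable_grow[OF p(1)]]) (simp add: shrink_grow)
  also have "\<dots> = Suc (card (removable p)) * ?f p + ?X"
    using card_addable[OF p(2)] by (simp add: sum.distrib)
  also have "?X = ?Y"
  proof -
    have "?X = (\<Sum>(r, s)\<in>(SIGMA r:addable p. removable (grow r p) - {r}). ?f (shrink s (grow r p)))"
      using finite_addable[OF p(2)] finG by (intro sum.Sigma) auto
    also have "\<dots> = (\<Sum>(s, r)\<in>(SIGMA s:removable p. addable (shrink s p) - {s}). ?f (grow r (shrink s p)))"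
    proof (rule sum.reindex_bij_witness[of _ prod.swap prod.swap])
      fix x assume "x \<in> (SIGMA r:addable p. removable (grow r p) - {r})"
      then obtain r s where x: "x = (r, s)" "r \<in> addable p" "s \<in> removable (grow r p)" "r \<noteq> s"
        by blast
      then show "prod.swap x \<in> (SIGMA s:removable p. addable (shrink s p) - {s})"
        using grow_shrink_swap[OF p(1) x(4)] by simp
      show "(case prod.swap x of (s, r) \<Rightarrow> ?f (grow r (shrink s p))) = (case x of (r, s) \<Rightarrow> ?f (shrink s (grow r p)))"
        using grow_shrink_commute[OF x(4), of p] by (simp add: x(1))
    next
      fix x assume "x \<in> (SIGMA s:removable p. addable (shrink s p) - {s})"
      then obtain s r where x: "x = (s, r)" "s \<in> removable p" "r \<in> addable (shrink s p)" "r \<noteq> s"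
        by blast
      then show "prod.swap x \<in> (SIGMA r:addable p. removable (grow r p) - {r})"
        using grow_shrink_swap[OF p(1) x(4)] by simp
    qed simp_all
    also have "\<dots> = ?Y"
      using finite_removable[OF p(2)] finS
      by (intro sum.Sigma[symmetric]) (auto intro: finite_addable)
    finally show ?thesis .
  qed
  also have "Suc (card (removable p)) * ?f p + ?Y = Suc n * ?f p"
  proof (cases n)
    case 0
    then have "cells p = {}"
      using p by simp
    then have "removable p = {}"
      by (auto simp: cells_def removable_def)
    then show ?thesis
      using 0 by simp
  next
    case (Suc m)
    have "Suc m * ?f p = (\<Sum>s\<in>removable p. Suc m * card (tableaux m (shrink s p)))"
      using card_tableaux_Suc[OF p(1,2), of m] Suc by (simp add: sum_distrib_left)
    also have "\<dots> = (\<Sum>s\<in>removable p. \<Sum>r\<in>addable (shrink s p). ?f (grow r (shrink s p)))"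
      using less.IH[of m] shrink_shapes[of p m] less.prems Suc by (intro sum.cong) auto
    also have "\<dots> = (\<Sum>s\<in>removable p. ?f p + (\<Sum>r\<in>addable (shrink s p) - {s}. ?f (grow r (shrink s p))))"
      by (intro sum.cong refl, subst sum.remove[OF finite_addable[OF finS] addable_shrink[OF p(1)]])
        (simp_all add: grow_shrink)
    also have "\<dots> = card (removable p) * ?f p + ?Y"
      by (simp add: sum.distrib)
    finally show ?thesis
      using Suc by simp
  qed
  finally show ?case .
qed

lemma finite_shapes: "finite (shapes n)"
  using bij_betw_finite[OF bij_betw_row] finite_young_diagrams by blast

text \<open>
  In \<open>\<Sum> (f q)\<^sup>2\<close> expand one factor by removing a box of \<open>q\<close>, and sum over the smaller shape first.
\<close>

lemma sum_card_tableaux_square: "(\<Sum>p\<in>shapes n. card (tableaux n p) ^ 2) = fact n"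
proof (induction n)
  case 0
  have "p = (\<lambda>_. 0)" if "p \<in> shapes 0" for p
  proof
    fix r
    have "(r, 0) \<notin> cells p"
      using that by (auto simp: shapes_def)
    then show "p r = 0"
      by (simp add: cells_def)
  qed
  moreover have "(\<lambda>_. 0) \<in> shapes 0"
    by (simp add: shapes_def cells_def monotone_def)
  ultimately have "shapes 0 = {\<lambda>_. 0}"
    by blast
  then show ?case
    by (simp add: tableaux_0 cells_def)
next
  case (Suc n)
  let ?f = "\<lambda>n p. card (tableaux n p)"
  have fin: "finite (cells p)" and anti: "antimono p" if "p \<in> shapes k" for p k
    using that by (simp_all add: shapes_def)
  have "(\<Sum>q\<in>shapes (Suc n). ?f (Suc n) q ^ 2)
    = (\<Sum>q\<in>shapes (Suc n). \<Sum>s\<in>removable q. ?f (Suc n) q * ?f n (shrink s q))"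
    by (intro sum.cong refl)
      (auto simp: power2_eq_square sum_distrib_left[symmetric] shapes_def intro: card_tableaux_Suc)
  also have "\<dots> = (\<Sum>(q, s)\<in>(SIGMA q:shapes (Suc n). removable q). ?f (Suc n) q * ?f n (shrink s q))"
    using finite_shapes fin by (intro sum.Sigma) (auto intro: finite_removable)
  also have "\<dots> = (\<Sum>(p, r)\<in>(SIGMA p:shapes n. addable p). ?f (Suc n) (grow r p) * ?f n p)"
    by (rule sum.reindex_bij_witness[of _ "\<lambda>(p, r). (grow r p, r)" "\<lambda>(q, s). (shrink s q, s)"])
      (auto simp: shrink_grow grow_shrink intro: grow_shapes shrink_shapes removable_grow addable_shrink
        dest: anti)
  also have "\<dots> = (\<Sum>p\<in>shapes n. \<Sum>r\<in>addable p. ?f (Suc n) (grow r p) * ?f n p)"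
    using finite_shapes fin by (intro sum.Sigma[symmetric]) (auto intro: finite_addable)
  also have "\<dots> = (\<Sum>p\<in>shapes n. Suc n * ?f n p ^ 2)"
    by (intro sum.cong refl)
      (simp add: sum_card_tableaux_grow power2_eq_square distrib_right mult.assoc flip: sum_distrib_right)
  also have "\<dots> = Suc n * fact n"
    unfolding Suc[symmetric] by (rule sum_distrib_left[symmetric])
  finally show ?case
    by simp
qed

lemma sum_card_Stab_square: "(\<Sum>\<beta> | young_diagram d \<beta>. card (Stab \<beta>) ^ 2) = fact d"
proof -
  have "(\<Sum>\<beta> | young_diagram d \<beta>. card (Stab \<beta>) ^ 2)
    = (\<Sum>\<beta> | young_diagram d \<beta>. card (tableaux d (row \<beta>)) ^ 2)"
    by (intro sum.cong refl) (simp add: Stab_eq_tableaux)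
  also have "\<dots> = (\<Sum>p\<in>shapes d. card (tableaux d p) ^ 2)"
    by (rule sum.reindex_bij_betw[OF bij_betw_row])
  finally show ?thesis
    by (simp add: sum_card_tableaux_square)
qed

section \<open>Matrix units\<close>

definition unit_family ::
    "nat list \<Rightarrow> filling \<Rightarrow> filling \<Rightarrow> nat list \<Rightarrow> (filling \<Rightarrow> complex) \<Rightarrow> (filling \<Rightarrow> complex)" where
  "unit_family la T S = (\<lambda>\<beta> v R. if \<beta> = la then v S * basis_vec T R else 0)"

lemma sum_galg_scale: "(\<Sum>x\<in>A. galg_scale (u x) (f x)) = (\<lambda>\<pi>. \<Sum>x\<in>A. u x * f x \<pi>)"
  by (induction A rule: infinite_finite_induct) (auto simp: galg_scale_def fun_eq_iff)

lemma galg_op_sum_left: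
  "galg_op d la (\<lambda>\<pi>. \<Sum>x\<in>A. u x * f x \<pi>) w R = (\<Sum>x\<in>A. u x * galg_op d la (f x) w R)"
proof -
  have "galg_op d la (\<lambda>\<pi>. \<Sum>x\<in>A. u x * f x \<pi>) w R
    = (\<Sum>\<sigma> | \<sigma> permutes {1..d}. \<Sum>x\<in>A. u x * (f x \<sigma> * perm_op d la \<sigma> w R))"
    by (simp add: galg_op_def sum_distrib_right mult.assoc)
  then show ?thesis
    by (subst (asm) sum.swap) (simp add: galg_op_def sum_distrib_left)
qed

text \<open>
  The elements \<open>e b\<close> acting as the matrix units are linearly independent, since \<open>coord b\<close> reads off the
  matrix entry with index \<open>b\<close>. There are \<open>d!\<close> of them, which is the dimension of the group algebra,
  so they span it, and an element with all coordinates 0 is 0.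
\<close>

lemma galg_faithful:
  assumes x: "x \<in> group_algebra d"
    and zero: "\<And>\<beta> R. young_diagram d \<beta> \<Longrightarrow> R \<in> Stab \<beta> \<Longrightarrow> galg_op d \<beta> x (basis_vec R) = (\<lambda>_. 0)"
  shows "x = (\<lambda>_. 0)"
proof -
  interpret vector_space galg_scale
    by unfold_locales (auto simp: galg_scale_def fun_eq_iff algebra_simps)
  define B where "B = (SIGMA \<beta>:{\<beta>. young_diagram d \<beta>}. Stab \<beta> \<times> Stab \<beta>)"
  have finB: "finite B"
    unfolding B_def using young_shape.finite_Stab[OF young_shape.intro]
    by (intro finite_SigmaI finite_young_diagrams) auto
  have cardB: "card B = fact d"
  proof -
    have "card B = (\<Sum>\<beta> | young_diagram d \<beta>. card (Stab \<beta> \<times> Stab \<beta>))"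
      unfolding B_def using young_shape.finite_Stab[OF young_shape.intro]
      by (intro card_SigmaI finite_young_diagrams) auto
    then show ?thesis
      using sum_card_Stab_square[of d] by (simp add: card_cartesian_product power2_eq_square)
  qed
  have "\<forall>b\<in>B. \<exists>y. realises d y (unit_family (fst b) (fst (snd b)) (snd (snd b)))"
    using young_shape.realisable_matrix_unit[OF young_shape.intro]
    by (auto simp: B_def realisable_def unit_family_def)
  then obtain e where e: "\<And>b. b \<in> B \<Longrightarrow> realises d (e b) (unit_family (fst b) (fst (snd b)) (snd (snd b)))"
    by metis
  define coord where "coord b y = galg_op d (fst b) y (basis_vec (snd (snd b))) (fst (snd b))" for b y
  have coord_e: "coord b (e b') = (if b = b' then 1 else 0)" if b: "b \<in> B" "b' \<in> B" for b b'
  proof -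
    have "young_diagram d (fst b)" "basis_vec (snd (snd b)) \<in> vspace (fst b)"
      using b(1) by (auto simp: B_def intro: basis_vec_vspace)
    then have "coord b (e b') = unit_family (fst b') (fst (snd b')) (snd (snd b')) (fst b)
        (basis_vec (snd (snd b))) (fst (snd b))"
      using e[OF b(2)] by (simp add: coord_def realises_def)
    then show ?thesis
      by (cases b; cases b') (auto simp: unit_family_def basis_vec_def)
  qed
  have inj: "inj_on e B"
    by (rule inj_onI) (metis coord_e zero_neq_one)
  have coord_sum: "coord b (\<Sum>v\<in>e ` B. galg_scale (u v) v) = u (e b)" if b: "b \<in> B" for b u
  proof -
    have "coord b (\<Sum>v\<in>e ` B. galg_scale (u v) v) = (\<Sum>v\<in>e ` B. u v * coord b v)"
      unfolding sum_galg_scale coord_def by (rule galg_op_sum_left)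
    also have "\<dots> = (\<Sum>b'\<in>B. u (e b') * coord b (e b'))"
      using inj by (simp add: sum.reindex)
    also have "\<dots> = (\<Sum>b'\<in>B. if b' = b then u (e b') else 0)"
      using b by (intro sum.cong refl) (auto simp: coord_e)
    finally show ?thesis
      using b finB by simp
  qed
  have indep: "independent (e ` B)"
  proof
    assume "dependent (e ` B)"
    then obtain u v where u: "v \<in> e ` B" "u v \<noteq> 0" "(\<Sum>v\<in>e ` B. galg_scale (u v) v) = 0"
      using finB by (auto simp: dependent_finite)
    then obtain b where b: "b \<in> B" "v = e b"
      by blast
    have "coord b 0 = 0"
      by (simp add: coord_def galg_op_def)
    then show False
      using coord_sum[OF b(1), of u] u b by simp
  qed
  let ?U = "galg_perm ` {\<sigma>. \<sigma> permutes {1..d}}"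
  have U: "y \<in> span ?U" if y: "y \<in> group_algebra d" for y
  proof -
    have "y = (\<lambda>\<pi>. \<Sum>\<sigma> | \<sigma> permutes {1..d}. y \<sigma> * galg_perm \<sigma> \<pi>)"
    proof
      fix \<pi>
      have "(\<Sum>\<sigma> | \<sigma> permutes {1..d}. y \<sigma> * galg_perm \<sigma> \<pi>)
        = (\<Sum>\<sigma> | \<sigma> permutes {1..d}. if \<sigma> = \<pi> then y \<sigma> else 0)"
        by (intro sum.cong refl) (auto simp: galg_perm_def)
      then show "y \<pi> = (\<Sum>\<sigma> | \<sigma> permutes {1..d}. y \<sigma> * galg_perm \<sigma> \<pi>)"
        using y finite_perms[of d] by (simp add: group_algebra_def)
    qed
    also have "\<dots> = (\<Sum>\<sigma> | \<sigma> permutes {1..d}. galg_scale (y \<sigma>) (galg_perm \<sigma>))"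
      by (rule sum_galg_scale[symmetric])
    also have "\<dots> \<in> span ?U"
      by (intro span_sum span_scale span_base) auto
    finally show ?thesis .
  qed
  have finU: "finite ?U"
    using finite_perms by blast
  have cardU: "card ?U \<le> fact d"
    using card_image_le[OF finite_perms, of galg_perm d] card_permutations[of "{1..d}" d] by simp
  have "x \<in> span (e ` B)"
  proof (rule ccontr)
    assume new: "x \<notin> span (e ` B)"
    \<comment> \<open>Otherwise \<open>d! + 1\<close> independent elements would lie in the span of \<open>d!\<close> permutations.\<close>
    have "insert x (e ` B) \<subseteq> span ?U"
      using x e U by (auto simp: realises_def)
    then have "card (insert x (e ` B)) \<le> card ?U"
      using independent_span_bound[OF finU independent_insertI[OF new indep]] by simp
    moreover have "x \<notin> e ` B"
      using new span_base by blast
    ultimately show False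
      using finB cardU cardB inj by (simp add: card_image)
  qed
  then obtain u where u: "x = (\<Sum>v\<in>e ` B. galg_scale (u v) v)"
    using finB by (auto simp: span_finite)
  have "u (e b) = 0" if "b \<in> B" for b
    using coord_sum[OF that, of u] zero[of "fst b" "snd (snd b)"] that u by (auto simp: coord_def B_def)
  then show ?thesis
    unfolding u sum_galg_scale by (intro ext sum.neutral) (metis imageE mult_zero_left)
qed

lemma galg_eqI:
  assumes x: "x \<in> group_algebra d" and y: "y \<in> group_algebra d"
    and eq: "\<And>\<beta> R. young_diagram d \<beta> \<Longrightarrow> R \<in> Stab \<beta> \<Longrightarrow>
      galg_op d \<beta> x (basis_vec R) = galg_op d \<beta> y (basis_vec R)"
  shows "x = y"
proof -
  have diff: "galg_op d \<beta> (\<lambda>\<pi>. x \<pi> - y \<pi>) v R = galg_op d \<beta> x v R - galg_op d \<beta> y v R" for \<beta> v R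
    by (simp add: galg_op_def left_diff_distrib sum_subtractf)
  have "(\<lambda>\<pi>. x \<pi> - y \<pi>) = (\<lambda>_. 0)"
  proof (rule galg_faithful)
    show "(\<lambda>\<pi>. x \<pi> - y \<pi>) \<in> group_algebra d"
      using x y by (simp add: group_algebra_def)
    show "galg_op d \<beta> (\<lambda>\<pi>. x \<pi> - y \<pi>) (basis_vec R) = (\<lambda>_. 0)"
      if "young_diagram d \<beta>" "R \<in> Stab \<beta>" for \<beta> R
      using eq[OF that] by (auto simp: diff fun_eq_iff)
  qed
  then show ?thesis
    by (simp add: fun_eq_iff)
qed

lemma matrix_unit_eqI:
  assumes x: "realises d x (unit_family la T S)"
  shows "matrix_unit d la T S = x"
proof -
  have x': "galg_op d \<beta> x (basis_vec R) = (if \<beta> = la \<and> R = S then basis_vec T else (\<lambda>_. 0))"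
    if "young_diagram d \<beta>" "R \<in> Stab \<beta>" for \<beta> R
    using x that basis_vec_vspace[of R \<beta>]
    by (auto simp: realises_def unit_family_def basis_vec_def)
  show ?thesis
    unfolding matrix_unit_def
  proof (rule the_equality)
    show "x \<in> group_algebra d \<and> (\<forall>\<beta>. young_diagram d \<beta> \<longrightarrow> (\<forall>R\<in>Stab \<beta>. galg_op d \<beta> x (basis_vec R) =
        (if \<beta> = la \<and> R = S then basis_vec T else (\<lambda>_. 0))))"
      using x x' by (simp add: realises_def)
  next
    fix y assume "y \<in> group_algebra d \<and> (\<forall>\<beta>. young_diagram d \<beta> \<longrightarrow> (\<forall>R\<in>Stab \<beta>. galg_op d \<beta> y (basis_vec R) =
        (if \<beta> = la \<and> R = S then basis_vec T else (\<lambda>_. 0))))"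
    then show "y = x"
      using x x' by (intro galg_eqI[of y d x]) (simp_all add: realises_def)
  qed
qed

lemma matrix_unit_realises:
  assumes "young_diagram d la" "T \<in> Stab la" "S \<in> Stab la"
  shows "realises d (matrix_unit d la T S) (unit_family la T S)"
proof -
  obtain x where "realises d x (unit_family la T S)"
    using young_shape.realisable_matrix_unit[OF young_shape.intro[OF assms(1)] assms(2,3)]
    by (auto simp: realisable_def unit_family_def)
  then show ?thesis
    using matrix_unit_eqI by blast
qed

theorem theorem6:
  fixes d :: nat and la :: "nat list" and T S :: filling and \<sigma> :: "nat \<Rightarrow> nat"
  assumes "d \<ge> 1"
    and "young_diagram d la"
    and "T \<in> Stab la" and "S \<in> Stab la"
    and "\<sigma> permutes {1..d}" and "\<sigma> \<circ> T = S"
  shows "\<exists>c::complex. c \<noteq> 0 \<and>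
    matrix_unit d la T S =
      galg_scale c
        (galg_mult d (galg_mult d (matrix_unit d la T T) (galg_perm (inv \<sigma>))) (matrix_unit d la S S))"
proof -
  define a where "a = perm_op d la (inv \<sigma>) (basis_vec S) T"
  have a: "a \<noteq> 0"
    unfolding a_def
    using young_shape.perm_op_coefficient_neq_0[OF young_shape.intro[OF assms(2)] assms(3-6)] .
  let ?x = "galg_mult d (galg_mult d (matrix_unit d la T T) (galg_perm (inv \<sigma>))) (matrix_unit d la S S)"
  let ?F = "\<lambda>\<beta> v. unit_family la T T \<beta> (perm_op d \<beta> (inv \<sigma>) (unit_family la S S \<beta> v))"
  have "realises d ?x ?F"
    by (intro realises_mult matrix_unit_realises realises_perm permutes_inv assms)
  then have "realises d (galg_scale (1 / a) ?x) (\<lambda>\<beta> v R. 1 / a * ?F \<beta> v R)"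
    by (rule realises_scale)
  moreover have "(\<lambda>\<beta> v R. 1 / a * ?F \<beta> v R) = unit_family la T S"
  proof (intro ext)
    fix \<beta> v R
    have "perm_op d la (inv \<sigma>) (\<lambda>R. v S * basis_vec S R)
      = (\<lambda>R. v S * perm_op d la (inv \<sigma>) (basis_vec S) R)"
      using perm_op_sum[of d la "inv \<sigma>" "\<lambda>_. v S" "\<lambda>_. basis_vec S" "{()}"] by simp
    then show "1 / a * ?F \<beta> v R = unit_family la T S \<beta> v R"
      using a by (simp add: unit_family_def a_def)
  qed
  ultimately have "matrix_unit d la T S = galg_scale (1 / a) ?x"
    using matrix_unit_eqI by metis
  then show ?thesis
    using a by (intro exI[of _ "1 / a"]) simp
qed

end
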